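(* Let $d\in\mathbb{N}$, let $\mathbb{T}^d:=\mathbb{R}^d/\mathbb{Z}^d$ be the $d$-dimensional unit torus (circumference $1$ along each dimension) equipped with its geodesic distance $\mathrm{dst}$, let $\kappa\in(0,\infty)$, and let $\rho\in\mathcal{P}(\mathbb{T}^d)$ be the uniform probability measure on $\mathbb{T}^d$. Call a minimizer $\nu\in\mathcal{M}_+(\mathbb{T}^d)$ of $\nu\mapsto\int_{\mathbb{T}^d}\mathrm{HK}_\kappa^2(\delta_x,\nu)\,d\rho(x)$ a barycenter. Then for $d>1$ there is no discrete barycenter. For $d=1$ there is no discrete barycenter when $\kappa\pi$ is irrational or $\kappa\pi>1$; otherwise discrete barycenters exist.
   Context: $\mathcal{M}_+(\mathbb{T}^d)$ and $\mathcal{P}(\mathbb{T}^d)$ denote the non-negative Radon measures and probability measures on $\mathbb{T}^d$. A measure is called discrete if it is an at most countable sum of weighted Dirac measures. For $\kappa\in(0,\infty)$ and $\mu,\nu\in\mathcal{M}_+(\mathbb{T}^d)$ the Hellinger--Kantorovich distance is $$\mathrm{HK}_\kappa^2(\mu,\nu) := \inf_{\gamma\in\mathcal{M}_+(\mathbb{T}^d\times\mathbb{T}^d)} \int \hat c_\kappa\,d\gamma + \mathrm{KL}(P_1\gamma|\mu)+\mathrm{KL}(P_2\gamma|\nu),$$ where $P_1\gamma,P_2\gamma$ are the two marginals of $\gamma$, $\hat c_\kappa(x,y) = -2\log\cos(\mathrm{dst}(x,y)/\kappa)$ if $\mathrm{dst}(x,y)\le\kappa\pi/2$ (with $-\log 0=+\infty$)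 and $+\infty$ otherwise, and $\mathrm{KL}(\mu|\nu)=\int\varphi(d\mu/d\nu)\,d\nu$ if $\mu\ll\nu$, $\mu\ge0$, and $+\infty$ otherwise, with $\varphi(s)=s\log s-s+1$ for $s>0$, $\varphi(0)=1$. With $\mathrm{Cos}(s):=\cos(\min\{|s|,\pi/2\})$ one has, as in the Euclidean case, $\mathrm{HK}_\kappa^2(\delta_x,\nu)=1+\nu(\mathbb{T}^d)-2\sqrt{\int\mathrm{Cos}^2(\mathrm{dst}(x,y)/\kappa)\,d\nu(y)}$. *)

theory Defs
  imports "HOL-Probability.Probability"
begin

section \<open>The flat torus\<close>

definition int_lattice :: "(real ^ 'n) set" where
  "int_lattice = {k. \<forall>i. k $ i \<in> \<int>}"

lemma int_lattice_zero: "0 \<in> int_lattice"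
  and int_lattice_add: "a \<in> int_lattice \<Longrightarrow> b \<in> int_lattice \<Longrightarrow> a + b \<in> int_lattice"
  and int_lattice_uminus: "a \<in> int_lattice \<Longrightarrow> - a \<in> int_lattice"
  and int_lattice_diff: "a \<in> int_lattice \<Longrightarrow> b \<in> int_lattice \<Longrightarrow> a - b \<in> int_lattice"
  by (auto simp: int_lattice_def)

lemma closed_int_lattice: "closed (int_lattice :: (real ^ 'n) set)"
proof -
  have eq: "(int_lattice :: (real ^ 'n) set) = (\<Inter>i\<in>UNIV. (\<lambda>x. x $ i) -` \<int>)"
    by (auto simp: int_lattice_def)
  show ?thesis
    unfolding eq
    by (intro closed_INT ballI closed_vimage[OF closed_Ints] continuous_on_component continuous_on_id)
qed

lemma infdist_int_lattice_uminus: "infdist (- x) int_lattice = infdist x int_lattice"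
proof -
  have "infdist (- y) int_lattice \<le> infdist y int_lattice" for y :: "real ^ 'n"
  proof (unfold infdist_notempty[OF ex_in_conv[THEN iffD1, OF exI, OF int_lattice_zero], of y],
      rule cINF_greatest)
    fix k :: "real ^ 'n" assume "k \<in> int_lattice"
    then show "infdist (- y) int_lattice \<le> dist y k"
      by (intro infdist_le2[OF int_lattice_uminus]) (auto simp: dist_minus)
  qed (use int_lattice_zero in blast)
  from this[of x] this[of "- x"] show ?thesis by simp
qed

lemma infdist_int_lattice_translate:
  assumes "k \<in> int_lattice"
  shows "infdist (x + k) int_lattice = infdist x int_lattice"
proof -
  have le: "infdist (y + l) int_lattice \<le> infdist y int_lattice" if l: "l \<in> int_lattice" for y l :: "real ^ 'n"
  proof (unfold infdist_notempty[OF ex_in_conv[THEN iffD1, OF exI, OF int_lattice_zero], of y],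
      rule cINF_greatest)
    fix j :: "real ^ 'n" assume "j \<in> int_lattice"
    then show "infdist (y + l) int_lattice \<le> dist y j"
      by (intro infdist_le2[OF int_lattice_add[OF _ l]]) auto
  qed (use int_lattice_zero in blast)
  from le[OF assms, of x] le[OF int_lattice_uminus[OF assms], of "x + k"] show ?thesis by simp
qed

lemma infdist_int_lattice_add:
  "infdist (x + y) int_lattice \<le> infdist x int_lattice + infdist y int_lattice"
proof -
  obtain k where k: "k \<in> int_lattice" "infdist y int_lattice = dist y k"
    using infdist_attains_inf[OF closed_int_lattice, of y] int_lattice_zero by blast
  have "infdist (x + y) int_lattice \<le> infdist (x + k) int_lattice + dist (x + y) (x + k)"
    by (rule infdist_triangle)
  then show ?thesis
    using k by (simp add: infdist_int_lattice_translate)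
qed

definition torus_rel :: "real ^ 'n \<Rightarrow> real ^ 'n \<Rightarrow> bool" where
  "torus_rel x y \<longleftrightarrow> x - y \<in> int_lattice"

lemma equivp_torus_rel: "equivp torus_rel"
proof (rule equivpI)
  show "reflp torus_rel"
    by (auto simp: reflp_def torus_rel_def int_lattice_zero)
  show "symp torus_rel"
    unfolding symp_def torus_rel_def using int_lattice_uminus by fastforce
  show "transp torus_rel"
    unfolding transp_def torus_rel_def
    by (metis int_lattice_add diff_add_cancel add_diff_eq)
qed

quotient_type 'n torus = "real ^ 'n" / torus_rel
  by (rule equivp_torus_rel)

lift_definition torus_proj :: "real ^ 'n \<Rightarrow> 'n torus" is "\<lambda>x. x" .

text \<open>
  The geodesic distance of the flat quotient is the distance between fibres,
  the infimum of \<open>norm (x - y - k)\<close> over integer vectors \<open>k\<close>. The topology (and hence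
  the Borel sigma algebra) is the one of this metric.
\<close>

instantiation torus :: (finite) metric_space
begin

lift_definition dist_torus :: "'a torus \<Rightarrow> 'a torus \<Rightarrow> real"
  is "\<lambda>x y. infdist (x - y) int_lattice"
proof -
  fix x x' y y' :: "real ^ 'a"
  assume "torus_rel x x'" "torus_rel y y'"
  then have "(x - x') - (y - y') \<in> int_lattice"
    by (auto simp: torus_rel_def intro: int_lattice_diff)
  from infdist_int_lattice_translate[OF this, of "x' - y'"]
  show "infdist (x - y) int_lattice = infdist (x' - y') int_lattice"
    by (simp add: algebra_simps)
qed

definition uniformity_torus :: "('a torus \<times> 'a torus) filter" where
  "uniformity_torus = (INF e\<in>{0<..}. principal {(x, y). dist x y < e})"

definition open_torus :: "'a torus set \<Rightarrow> bool" where
  "open_torus U \<longleftrightarrow> (\<forall>x\<in>U. \<forall>\<^sub>F (x', y) in uniformity. x' = x \<longrightarrow> y \<in> U)"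

instance
proof
  fix x y z :: "'a torus"
  show "dist x y = 0 \<longleftrightarrow> x = y"
  proof transfer
    fix x y :: "real ^ 'a"
    show "infdist (x - y) int_lattice = 0 \<longleftrightarrow> torus_rel x y"
      using in_closed_iff_infdist_zero[OF closed_int_lattice, of "x - y"] int_lattice_zero
      by (auto simp: torus_rel_def)
  qed
  show "dist x y \<le> dist x z + dist y z"
  proof transfer
    fix x y z :: "real ^ 'a"
    show "infdist (x - y) int_lattice
        \<le> infdist (x - z) int_lattice + infdist (y - z) int_lattice"
      using infdist_int_lattice_add[of "x - z" "- (y - z)"]
      by (simp only: infdist_int_lattice_uminus) simp
  qed
qed (simp_all only: uniformity_torus_def open_torus_def)

end

lemma dist_torus_proj: "dist (torus_proj x) (torus_proj y) = infdist (x - y) int_lattice"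
  by transfer simp

lemma continuous_on_torus_proj: "continuous_on S (torus_proj :: real ^ 'n \<Rightarrow> 'n::finite torus)"
proof (rule continuous_on_iff[THEN iffD2], intro ballI allI impI)
  fix x :: "real ^ 'n" and e :: real assume "e > 0"
  moreover have "dist (torus_proj y) (torus_proj x) \<le> dist y x" for y
    using infdist_le[OF int_lattice_zero, of "y - x"] by (simp add: dist_torus_proj dist_norm)
  ultimately show "\<exists>d>0. \<forall>y\<in>S. dist y x < d \<longrightarrow> dist (torus_proj y) (torus_proj x) < e"
    by (meson le_less_trans)
qed

lemma borel_measurable_torus_proj [measurable]: "torus_proj \<in> borel_measurable borel"
  by (intro borel_measurable_continuous_onI continuous_on_torus_proj)

text \<open>The image of Lebesgue measure on the unit cube; here \<open>1\<close> is the all-ones vector.\<close>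

definition uniform_torus :: "'n::finite torus measure" where
  "uniform_torus = distr (uniform_measure lborel (cbox 0 1)) borel torus_proj"


section \<open>Measures\<close>

text \<open>
  On a compact metric space, such as the torus or its square, every finite Borel measure is
  regular, so these are exactly the non-negative Radon measures.
\<close>

definition radon_measures :: "'a::metric_space measure set" where
  "radon_measures = {\<mu>. sets \<mu> = sets borel \<and> finite_measure \<mu>}"

text \<open>Weights may vanish, so finite sums of Dirac measures and the zero measure are included.\<close>

definition discrete_measure :: "'a::metric_space measure \<Rightarrow> bool" where
  "discrete_measure \<nu> \<longleftrightarrow> sets \<nu> = sets borel \<and>
    (\<exists>(w :: nat \<Rightarrow> ennreal) x. \<forall>B\<in>sets borel.
      emeasure \<nu> B = (\<Sum>i. w i * emeasure (return borel (x i)) B))"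


section \<open>The Hellinger--Kantorovich distance\<close>

definition entropy_fun :: "real \<Rightarrow> real" where
  "entropy_fun s = (if s = 0 then 1 else s * ln s - s + 1)"

text \<open>
  Only used for finite measures, where the Radon--Nikodym derivative is finite almost everywhere
  and \<open>enn2real\<close> loses nothing. Note the argument order of \<open>absolutely_continuous\<close> and
  \<open>RN_deriv\<close>: the dominating measure comes first.
\<close>

definition KL_div :: "'a measure \<Rightarrow> 'a measure \<Rightarrow> ennreal" where
  "KL_div \<mu> \<nu> = (if absolutely_continuous \<nu> \<mu>
     then \<integral>\<^sup>+x. ennreal (entropy_fun (enn2real (RN_deriv \<nu> \<mu> x))) \<partial>\<nu>
     else \<infinity>)"

text \<open>\<open>-log\<close> on the unit interval, with \<open>-log 0 = \<infinity>\<close>.\<close>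

definition neg_log :: "real \<Rightarrow> ennreal" where
  "neg_log t = (if t = 0 then \<infinity> else ennreal (- ln t))"

definition HK_cost :: "real \<Rightarrow> 'a::metric_space \<Rightarrow> 'a \<Rightarrow> ennreal" where
  "HK_cost \<kappa> x y = (if dist x y \<le> \<kappa> * pi / 2 then 2 * neg_log (cos (dist x y / \<kappa>)) else \<infinity>)"

definition HK_sq :: "real \<Rightarrow> 'a::metric_space measure \<Rightarrow> 'a measure \<Rightarrow> ennreal" where
  "HK_sq \<kappa> \<mu> \<nu> = (INF \<gamma>\<in>radon_measures.
     (\<integral>\<^sup>+(x, y). HK_cost \<kappa> x y \<partial>\<gamma>)
       + KL_div (distr \<gamma> borel fst) \<mu> + KL_div (distr \<gamma> borel snd) \<nu>)"

definition HK_objective :: "real \<Rightarrow> 'a::metric_space measure \<Rightarrow> 'a measure \<Rightarrow> ennreal" where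
  "HK_objective \<kappa> \<rho> \<nu> = (\<integral>\<^sup>+x. HK_sq \<kappa> (return borel x) \<nu> \<partial>\<rho>)"

definition HK_barycenter :: "real \<Rightarrow> 'a::metric_space measure \<Rightarrow> 'a measure \<Rightarrow> bool" where
  "HK_barycenter \<kappa> \<rho> \<nu> \<longleftrightarrow> \<nu> \<in> radon_measures \<and>
     (\<forall>\<nu>'\<in>radon_measures. HK_objective \<kappa> \<rho> \<nu> \<le> HK_objective \<kappa> \<rho> \<nu>')"

end

(*
  The functional is explicit: by convex duality for the entropy, HK^2(delta_x, nu) equals
  1 + nu(T) - 2 sqrt (F x), where F = k * nu is the potential of nu for the kernel
  k = Cos^2 (dst / kappa). Completing the square in sqrt F and integrating shows that nu is a
  barycenter iff F is constant, equal to the square of the total mass K of k.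

  So the question is whether a discrete nu can have a constant potential, and singularities of k
  decide it. If kappa * pi > 1, the kernel around an atom has a convex kink at the antipodal point,
  while k is semiconvex everywhere, so the kink survives in F. If kappa * pi <= 1, the second
  derivative of k jumps across the sphere of radius R = kappa * pi / 2, and the jumps at a point p
  must cancel among the atoms at distance R from p. For d > 1 some p on the sphere around a given
  atom has no other atom at distance R. For d = 1 cancellation makes the atomic masses invariant
  under translation by kappa * pi, which is impossible for irrational kappa * pi and finite mass.
  For rational kappa * pi <= 1 equal weights on a grid work, because of cos^2 + sin^2 = 1.
*)
theory Submission
  imports Defs "HOL-Real_Asymp.Real_Asymp"
begin

section \<open>The Hellinger--Kantorovich distance to a Dirac measure\<close>

text \<open>The square of the cosine is C^1 at its edge, so for \<kappa> * pi \<le> 1 the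
  obstruction sits in the second derivative. A potential may superpose infinitely many atoms, hence
  its jump cannot be read off from a finite sum. It is extracted by the odd difference
  \<open>third_diff\<close>: divided by h^2 it is 0 for a constant potential, tends to 0 for kernels
  around atoms off the sphere, and tends to -2/\<kappa>^2 or 2/\<kappa>^2 where the line leaves or
  enters the ball around an atom. For \<kappa> * pi \<le> 1 the gradient of the kernel is Lipschitz,
  which bounds the quotient uniformly in the atom and the step; dominated convergence then turns
  constancy of the potential into a linear relation between masses of atoms. Beyond \<kappa> * pi =
  1 the kernel is no longer C^1 and second differences are bounded only from below, so that case is
  settled by an inequality. At \<kappa> * pi = 1 the balls around neighbouring lattice points touch.
  For d > 1 the point p therefore avoids all lifts of the atoms, including the other lifts of the
  atom under study; for d = 1 this value is rational.\<close>

definition trunc_cos_sq :: "real \<Rightarrow> real" where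
  "trunc_cos_sq s = (cos (min \<bar>s\<bar> (pi / 2)))\<^sup>2"

definition HK_kernel :: "real \<Rightarrow> 'a::metric_space \<Rightarrow> 'a \<Rightarrow> real" where
  "HK_kernel \<kappa> x y = trunc_cos_sq (dist x y / \<kappa>)"

definition HK_potential :: "real \<Rightarrow> 'a::metric_space measure \<Rightarrow> 'a \<Rightarrow> real" where
  "HK_potential \<kappa> \<nu> x = (\<integral>y. HK_kernel \<kappa> x y \<partial>\<nu>)"

section \<open>Bounds and continuity of the kernel and the potential\<close>

lemma trunc_cos_sq_nonneg [simp]: "0 \<le> trunc_cos_sq s"
  by (simp add: trunc_cos_sq_def)

lemma trunc_cos_sq_le_1 [simp]: "trunc_cos_sq s \<le> 1"
  by (simp add: trunc_cos_sq_def abs_square_le_1)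

lemma trunc_cos_sq_inside: "\<bar>s\<bar> \<le> pi / 2 \<Longrightarrow> trunc_cos_sq s = (cos s)\<^sup>2"
  by (cases "s \<ge> 0") (simp_all add: trunc_cos_sq_def)

lemma trunc_cos_sq_outside: "pi / 2 \<le> \<bar>s\<bar> \<Longrightarrow> trunc_cos_sq s = 0"
  by (simp add: trunc_cos_sq_def min_absorb2)

lemma trunc_cos_sq_antimono:
  assumes "0 \<le> r" "r \<le> s"
  shows "trunc_cos_sq s \<le> trunc_cos_sq r"
proof -
  have "cos (min s (pi / 2)) \<le> cos (min r (pi / 2))"
    using assms pi_gt_zero by (intro cos_monotone_0_pi_le) (auto simp: min_le_iff_disj)
  moreover have "0 \<le> cos (min s (pi / 2))"
    using assms by (intro cos_ge_zero) (auto intro: order_trans[of _ 0])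
  ultimately show ?thesis
    using assms by (simp add: trunc_cos_sq_def power_mono)
qed

lemma cos_diff_le: "\<bar>cos a - cos b\<bar> \<le> \<bar>a - b\<bar>" for a b :: real
proof -
  have "norm (cos a - cos b) \<le> 1 * norm (a - b)"
    by (rule field_differentiable_bound[of UNIV cos "\<lambda>x. - sin x"])
      (auto intro!: derivative_eq_intros)
  then show ?thesis by simp
qed

lemma sin_diff_le: "\<bar>sin a - sin b\<bar> \<le> \<bar>a - b\<bar>" for a b :: real
proof -
  have "norm (sin a - sin b) \<le> 1 * norm (a - b)"
    by (rule field_differentiable_bound[of UNIV sin cos])
      (auto intro!: derivative_eq_intros)
  then show ?thesis by simp
qed

lemma trunc_cos_sq_lipschitz: "\<bar>trunc_cos_sq r - trunc_cos_sq s\<bar> \<le> 2 * \<bar>r - s\<bar>"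
proof -
  let ?a = "min \<bar>r\<bar> (pi / 2)" and ?b = "min \<bar>s\<bar> (pi / 2)"
  have "\<bar>trunc_cos_sq r - trunc_cos_sq s\<bar> = \<bar>cos ?a + cos ?b\<bar> * \<bar>cos ?a - cos ?b\<bar>"
  proof -
    have "c\<^sup>2 - d\<^sup>2 = (c + d) * (c - d)" for c d :: real
      by (simp add: power2_eq_square algebra_simps)
    then show ?thesis by (simp only: trunc_cos_sq_def abs_mult)
  qed
  also have "\<dots> \<le> 2 * \<bar>?a - ?b\<bar>"
  proof (rule mult_mono[OF _ cos_diff_le])
    show "\<bar>cos ?a + cos ?b\<bar> \<le> 2"
      by (rule order_trans[OF abs_triangle_ineq add_mono[OF abs_cos_le_one abs_cos_le_one, simplified]])
  qed auto
  also have "\<dots> \<le> 2 * \<bar>r - s\<bar>"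
    by (auto simp: min_def)
  finally show ?thesis .
qed

lemma HK_kernel_nonneg [simp]: "0 \<le> HK_kernel \<kappa> x y"
  and HK_kernel_le_1 [simp]: "HK_kernel \<kappa> x y \<le> 1"
  by (simp_all add: HK_kernel_def)

lemma HK_kernel_commute: "HK_kernel \<kappa> x y = HK_kernel \<kappa> y x"
  by (simp add: HK_kernel_def dist_commute)

lemma HK_kernel_lipschitz:
  assumes "0 < \<kappa>"
  shows "\<bar>HK_kernel \<kappa> x z - HK_kernel \<kappa> y z\<bar> \<le> 2 / \<kappa> * dist x y"
proof -
  have "\<bar>HK_kernel \<kappa> x z - HK_kernel \<kappa> y z\<bar> \<le> 2 * \<bar>dist x z / \<kappa> - dist y z / \<kappa>\<bar>"
    unfolding HK_kernel_def by (rule trunc_cos_sq_lipschitz)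
  also have "\<dots> = 2 / \<kappa> * \<bar>dist x z - dist y z\<bar>"
    using assms by (simp flip: diff_divide_distrib)
  also have "\<dots> \<le> 2 / \<kappa> * dist x y"
    using assms abs_dist_diff_le[of x z y]
    by (intro mult_left_mono) (auto simp: dist_commute)
  finally show ?thesis .
qed

lemma continuous_on_trunc_cos_sq: "continuous_on A trunc_cos_sq"
  unfolding trunc_cos_sq_def[abs_def] by (intro continuous_intros)

lemma continuous_on_HK_kernel [continuous_intros]:
  assumes "continuous_on A f" "continuous_on A g"
  shows "continuous_on A (\<lambda>a. HK_kernel \<kappa> (f a) (g a))"
proof (cases "\<kappa> = 0")
  \<comment> \<open>Division by zero yields 0, so here the kernel is constantly 1.\<close>
  case True
  then show ?thesis by (simp add: HK_kernel_def)
next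
  case False
  then show ?thesis
    unfolding HK_kernel_def
    using assms by (intro continuous_on_compose2[OF continuous_on_trunc_cos_sq[of UNIV]]
        continuous_intros) auto
qed

lemma borel_measurable_HK_kernel [measurable]:
  "HK_kernel \<kappa> x \<in> borel_measurable borel"
  by (intro borel_measurable_continuous_onI continuous_on_HK_kernel continuous_intros)

lemma integrable_HK_kernel:
  assumes "\<nu> \<in> radon_measures"
  shows "integrable \<nu> (HK_kernel \<kappa> x)"
proof -
  interpret finite_measure \<nu> using assms by (simp add: radon_measures_def)
  have [measurable_cong]: "sets \<nu> = sets borel" using assms by (simp add: radon_measures_def)
  show ?thesis
    by (rule integrable_const_bound[of _ 1]) auto
qed

lemma HK_potential_nonneg [simp]: "0 \<le> HK_potential \<kappa> \<nu> x"
  by (simp add: HK_potential_def)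

lemma HK_potential_le_mass:
  assumes "\<nu> \<in> radon_measures"
  shows "HK_potential \<kappa> \<nu> x \<le> measure \<nu> UNIV"
proof -
  interpret finite_measure \<nu> using assms by (simp add: radon_measures_def)
  have sp: "space \<nu> = UNIV"
    using assms sets_eq_imp_space_eq[of \<nu> borel] by (simp add: radon_measures_def)
  have "HK_potential \<kappa> \<nu> x \<le> (\<integral>y. 1 \<partial>\<nu>)"
    unfolding HK_potential_def using integrable_HK_kernel[OF assms]
    by (intro integral_mono) auto
  then show ?thesis by (simp add: sp)
qed

lemma HK_potential_lipschitz:
  assumes "0 < \<kappa>" "\<nu> \<in> radon_measures"
  shows "\<bar>HK_potential \<kappa> \<nu> x - HK_potential \<kappa> \<nu> y\<bar> \<le> 2 / \<kappa> * measure \<nu> UNIV * dist x y"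
proof -
  interpret finite_measure \<nu> using assms by (simp add: radon_measures_def)
  have sp: "space \<nu> = UNIV"
    using assms sets_eq_imp_space_eq[of \<nu> borel] by (simp add: radon_measures_def)
  note int = integrable_HK_kernel[OF assms(2)]
  have "HK_potential \<kappa> \<nu> x - HK_potential \<kappa> \<nu> y
      = (\<integral>z. HK_kernel \<kappa> x z - HK_kernel \<kappa> y z \<partial>\<nu>)"
    unfolding HK_potential_def using int by simp
  also have "\<bar>\<dots>\<bar> \<le> (\<integral>z. \<bar>HK_kernel \<kappa> x z - HK_kernel \<kappa> y z\<bar> \<partial>\<nu>)"
    by (rule integral_abs_bound)
  also have "\<dots> \<le> (\<integral>z. 2 / \<kappa> * dist x y \<partial>\<nu>)"
    using int HK_kernel_lipschitz[OF assms(1)]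
    by (intro integral_mono) auto
  finally show ?thesis by (simp add: sp mult_ac)
qed

lemma continuous_on_HK_potential:
  assumes "0 < \<kappa>" "\<nu> \<in> radon_measures"
  shows "continuous_on A (HK_potential \<kappa> \<nu>)"
proof -
  have "(2 / \<kappa> * measure \<nu> UNIV)-lipschitz_on A (HK_potential \<kappa> \<nu>)"
    using assms HK_potential_lipschitz[OF assms]
    by (intro lipschitz_onI) (auto simp: dist_real_def)
  then show ?thesis by (rule lipschitz_on_continuous_on)
qed

section \<open>Transport cost and entropy: pointwise duality\<close>

text \<open>The factor 2 of the cost becomes the square of the cosine. The cost is infinite exactly
  where the kernel vanishes, so the edge \<open>dist x y = \<kappa> * pi / 2\<close> and the
  exterior are treated alike.\<close>

lemma HK_cost_eq_neg_log:
  assumes "0 < \<kappa>"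
  shows "HK_cost \<kappa> x y = neg_log (HK_kernel \<kappa> x y)"
proof (cases "dist x y \<le> \<kappa> * pi / 2")
  case True
  then have le: "dist x y / \<kappa> \<le> pi / 2"
    using assms by (simp add: field_simps)
  define c where "c = cos (dist x y / \<kappa>)"
  have "0 \<le> dist x y / \<kappa>" using assms by simp
  have c: "0 \<le> c" unfolding c_def
    using le \<open>0 \<le> dist x y / \<kappa>\<close> pi_gt_zero by (intro cos_ge_zero) linarith+
  have "c \<le> 1" by (simp add: c_def)
  have k: "HK_kernel \<kappa> x y = c\<^sup>2"
    using le assms by (simp add: HK_kernel_def trunc_cos_sq_inside c_def)
  show ?thesis
  proof (cases "c = 0")
    case True
    then show ?thesis using \<open>dist x y \<le> \<kappa> * pi / 2\<close>
      by (simp add: HK_cost_def k neg_log_def ennreal_mult_top flip: c_def)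
  next
    case False
    have "2 * ennreal (- ln c) = ennreal (2 * (- ln c))"
      using c False \<open>c \<le> 1\<close> by (subst ennreal_mult) (auto simp: ln_le_zero_iff)
    also have "2 * (- ln c) = - ln (c\<^sup>2)"
      using c False by (simp add: ln_realpow)
    finally show ?thesis using \<open>dist x y \<le> \<kappa> * pi / 2\<close> False
      by (simp add: HK_cost_def k neg_log_def flip: c_def)
  qed
next
  case False
  then have "pi / 2 \<le> \<bar>dist x y / \<kappa>\<bar>"
    using assms by (simp add: field_simps)
  then show ?thesis
    using False by (simp add: HK_cost_def HK_kernel_def trunc_cos_sq_outside neg_log_def)
qed

text \<open>Fenchel-Young inequality: \<open>exp t - 1\<close> is the convex conjugate of the
  entropy. It is \<open>1 + r \<le> exp r\<close> at \<open>r = t - ln s\<close>.\<close>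

lemma entropy_fun_ge:
  assumes "0 \<le> s"
  shows "s * t - exp t + 1 \<le> entropy_fun s"
proof (cases "s = 0")
  case False
  with assms have s: "0 < s" by simp
  have "1 + (t - ln s) \<le> exp (t - ln s)" by (rule exp_ge_add_one_self)
  also have "\<dots> = exp t / s" using s by (simp add: exp_diff)
  finally have "s * (1 + (t - ln s)) \<le> s * (exp t / s)"
    using s by (intro mult_left_mono) auto
  then have "s * (1 + (t - ln s)) \<le> exp t" using s by simp
  then show ?thesis using s by (simp add: entropy_fun_def algebra_simps)
qed (simp add: entropy_fun_def)

lemma entropy_fun_nonneg: "0 \<le> s \<Longrightarrow> 0 \<le> entropy_fun s"
  using entropy_fun_ge[of s 0] by simp

lemma borel_measurable_entropy_fun [measurable]: "entropy_fun \<in> borel_measurable borel"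
  unfolding entropy_fun_def[abs_def] by measurable

lemma borel_measurable_neg_log [measurable]: "neg_log \<in> borel_measurable borel"
  unfolding neg_log_def[abs_def] by measurable

text \<open>
  Both sides carry one sign part of \<open>t * s\<close> so that no subtraction occurs in \<open>ennreal\<close>.
\<close>

lemma neg_log_duality:
  assumes "0 \<le> s" "0 \<le> k" "k \<le> 1"
  shows "ennreal (max t 0 * s) + 1 \<le>
    ennreal s * neg_log k + ennreal (entropy_fun s) + ennreal (exp t * k) + ennreal (max (- t) 0 * s)"
proof (cases "k = 0")
  case True
  then show ?thesis
    using assms by (cases "s = 0") (auto simp: neg_log_def entropy_fun_def ennreal_mult_top)
next
  case False
  then have k: "0 < k" using assms by simp
  \<comment> \<open>Shifting the dual variable by \<open>ln k\<close> absorbs the transport cost;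
    the exponential term becomes \<open>exp t * k\<close>, which integrates to the
    potential.\<close>
  have "s * (t + ln k) - exp t * k + 1 \<le> entropy_fun s"
    using entropy_fun_ge[OF assms(1), of "t + ln k"] k by (simp add: exp_add)
  then have "max t 0 * s + 1 \<le>
      s * (- ln k) + entropy_fun s + exp t * k + max (- t) 0 * s"
    by (auto simp: max_def algebra_simps)
  then have "ennreal (max t 0 * s + 1) \<le>
      ennreal (s * (- ln k) + entropy_fun s + exp t * k + max (- t) 0 * s)"
    by (rule ennreal_leI)
  also have "\<dots> = ennreal s * neg_log k + ennreal (entropy_fun s) + ennreal (exp t * k)
      + ennreal (max (- t) 0 * s)"
  proof -
    have "0 \<le> - ln k" using k assms by simp
    show ?thesis
      using k assms entropy_fun_nonneg[OF assms(1)] \<open>0 \<le> - ln k\<close>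
      by (simp only: neg_log_def ennreal_plus ennreal_mult if_False mult_nonneg_nonneg
          add_nonneg_nonneg max.cobounded2 exp_ge_zero less_imp_le order.refl refl
          less_imp_neq[symmetric])
  qed
  finally show ?thesis using assms by simp
qed

text \<open>A concrete real density replaces the chosen \<open>RN_deriv\<close>, with which it
  agrees almost everywhere.\<close>

lemma KL_div_density:
  assumes "finite_measure \<nu>" and f [measurable]: "f \<in> borel_measurable \<nu>"
    and nn: "\<And>x. 0 \<le> f x" and "finite_measure \<mu>"
    and eq: "density \<nu> (\<lambda>x. ennreal (f x)) = \<mu>"
  shows "KL_div \<mu> \<nu> = (\<integral>\<^sup>+x. ennreal (entropy_fun (f x)) \<partial>\<nu>)"
proof -
  interpret finite_measure \<nu> by fact
  have ac: "absolutely_continuous \<nu> \<mu>"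
    unfolding eq[symmetric] by (rule absolutely_continuousI_density) simp
  have "AE x in \<nu>. ennreal (f x) = RN_deriv \<nu> \<mu> x"
    by (rule RN_deriv_unique) (simp_all add: eq)
  then have "AE x in \<nu>. enn2real (RN_deriv \<nu> \<mu> x) = f x"
    by eventually_elim (metis enn2real_ennreal nn)
  then have "(\<integral>\<^sup>+x. ennreal (entropy_fun (enn2real (RN_deriv \<nu> \<mu> x))) \<partial>\<nu>)
      = (\<integral>\<^sup>+x. ennreal (entropy_fun (f x)) \<partial>\<nu>)"
    by (intro nn_integral_cong_AE) auto
  with ac show ?thesis by (simp add: KL_div_def)
qed

lemma absolutely_continuous_finite_density:
  assumes "finite_measure \<nu>" "finite_measure \<mu>" "sets \<mu> = sets \<nu>" "absolutely_continuous \<nu> \<mu>"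
  obtains f :: "'a \<Rightarrow> real" where "f \<in> borel_measurable \<nu>" "\<And>x. 0 \<le> f x"
    "density \<nu> (\<lambda>x. ennreal (f x)) = \<mu>"
proof
  interpret finite_measure \<nu> by fact
  let ?f = "\<lambda>x. enn2real (RN_deriv \<nu> \<mu> x)"
  show "?f \<in> borel_measurable \<nu>" by measurable
  have "AE x in \<nu>. RN_deriv \<nu> \<mu> x \<noteq> \<infinity>"
    using assms
    by (intro RN_deriv_finite) (auto simp: finite_measure.sigma_finite_measure)
  then have "AE x in \<nu>. ennreal (?f x) = RN_deriv \<nu> \<mu> x"
    by eventually_elim (simp add: less_top)
  then have "density \<nu> (\<lambda>x. ennreal (?f x)) = density \<nu> (RN_deriv \<nu> \<mu>)"
    by (intro density_cong) auto
  then show "density \<nu> (\<lambda>x. ennreal (?f x)) = \<mu>"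
    using assms by (simp add: density_RN_deriv)
qed simp

lemma ennreal_HK_potential:
  assumes "\<nu> \<in> radon_measures"
  shows "(\<integral>\<^sup>+y. ennreal (HK_kernel \<kappa> x y) \<partial>\<nu>) = ennreal (HK_potential \<kappa> \<nu> x)"
  unfolding HK_potential_def
  by (rule nn_integral_eq_integral[OF integrable_HK_kernel[OF assms]]) simp

lemma radon_measuresD:
  assumes "\<nu> \<in> radon_measures"
  shows "sets \<nu> = sets borel" "space \<nu> = UNIV" "finite_measure \<nu>"
    "emeasure \<nu> UNIV = ennreal (measure \<nu> UNIV)"
proof -
  show s: "sets \<nu> = sets borel" and f: "finite_measure \<nu>"
    using assms by (auto simp: radon_measures_def)
  show "space \<nu> = UNIV" using sets_eq_imp_space_eq[OF s] by simp
  show "emeasure \<nu> UNIV = ennreal (measure \<nu> UNIV)"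
    by (rule finite_measure.emeasure_eq_measure[OF f])
qed

section \<open>The two bounds for the distance to a Dirac measure\<close>

lemma borel_measurable_fst_snd:
  "(fst :: 'a::metric_space \<times> 'b::metric_space \<Rightarrow> 'a) \<in> borel_measurable borel"
  "(snd :: 'a::metric_space \<times> 'b::metric_space \<Rightarrow> 'b) \<in> borel_measurable borel"
  by (intro borel_measurable_continuous_onI continuous_intros)+

lemma borel_measurable_HK_cost:
  assumes "0 < \<kappa>"
  shows "(\<lambda>(x, y). HK_cost \<kappa> x y) \<in> borel_measurable borel"
proof -
  have "(\<lambda>p. HK_kernel \<kappa> (fst p) (snd p)) \<in> borel_measurable borel"
    by (intro borel_measurable_continuous_onI continuous_intros)
  from measurable_compose[OF this borel_measurable_neg_log] show ?thesis
    by (simp add: HK_cost_eq_neg_log[OF assms] split_beta')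
qed

text \<open>
  Weak duality with the potentials \<open>- t\<close> at \<open>x\<close> and \<open>t\<close> on the support of \<open>\<nu>\<close>; the optimal choice
  is \<open>exp t = 1 / sqrt F\<close>, with \<open>F\<close> the value of \<open>HK_potential\<close>.
\<close>

lemma HK_sq_dirac_dual:
  assumes "0 < \<kappa>" and \<nu>: "\<nu> \<in> radon_measures"
  shows "1 + emeasure \<nu> UNIV \<le> HK_sq \<kappa> (return borel x) \<nu>
    + ennreal (exp t * HK_potential \<kappa> \<nu> x + exp (- t))"
proof -
  note \<nu>D = radon_measuresD[OF \<nu>]
  interpret \<nu>: finite_measure \<nu> by (rule \<nu>D)
  have [measurable_cong]: "sets \<nu> = sets borel" by (rule \<nu>D)
  let ?F = "HK_potential \<kappa> \<nu> x"
  define R where "R = ennreal (exp t * ?F + exp (- t))"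
  have main: "1 + emeasure \<nu> UNIV \<le> (\<integral>\<^sup>+(x, y). HK_cost \<kappa> x y \<partial>\<gamma>)
      + KL_div (distr \<gamma> borel fst) (return borel x) + KL_div (distr \<gamma> borel snd) \<nu> + R"
    if \<gamma>: "\<gamma> \<in> radon_measures" for \<gamma> :: "('a \<times> 'a) measure"
  proof -
    note \<gamma>D = radon_measuresD[OF \<gamma>]
    interpret \<gamma>: finite_measure \<gamma> by (rule \<gamma>D)
    have [measurable_cong]: "sets \<gamma> = sets borel" by (rule \<gamma>D)
    note [measurable] = borel_measurable_fst_snd borel_measurable_HK_cost[OF assms(1)]
    let ?\<gamma>1 = "distr \<gamma> borel fst" and ?\<gamma>2 = "distr \<gamma> borel snd"
    have fin: "finite_measure ?\<gamma>1" "finite_measure ?\<gamma>2"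
      by (intro \<gamma>.finite_measure_distr; measurable)+
    have finx: "finite_measure (return borel x)"
      by (intro prob_space.finite_measure prob_space_return) simp
    show ?thesis
    proof (cases "absolutely_continuous (return borel x) ?\<gamma>1 \<and> absolutely_continuous \<nu> ?\<gamma>2")
      case False
      then show ?thesis by (auto simp: KL_div_def)
    next
      case True
      obtain a where a [measurable]: "a \<in> borel_measurable (return borel x)"
        and a_nn: "\<And>y. 0 \<le> a y" and a_eq: "density (return borel x) (\<lambda>y. ennreal (a y)) = ?\<gamma>1"
        using absolutely_continuous_finite_density[OF finx fin(1)] True by auto
      obtain s where s [measurable]: "s \<in> borel_measurable \<nu>"
        and s_nn: "\<And>y. 0 \<le> s y" and s_eq: "density \<nu> (\<lambda>y. ennreal (s y)) = ?\<gamma>2"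
        using absolutely_continuous_finite_density[OF \<nu>D(3) fin(2)] True \<nu>D(1) by auto
      have KL1: "KL_div ?\<gamma>1 (return borel x) = ennreal (entropy_fun (a x))"
        using KL_div_density[OF finx a a_nn fin(1) a_eq] a by (simp add: nn_integral_return)
      have KL2: "KL_div ?\<gamma>2 \<nu> = (\<integral>\<^sup>+y. ennreal (entropy_fun (s y)) \<partial>\<nu>)"
        by (rule KL_div_density[OF \<nu>D(3) s s_nn fin(2) s_eq])
      have "ennreal (a x) = emeasure (density (return borel x) (\<lambda>y. ennreal (a y))) UNIV"
        using a by (simp add: emeasure_density nn_integral_return)
      also have "\<dots> = emeasure \<gamma> UNIV"
        unfolding a_eq by (simp add: emeasure_distr \<gamma>D)
      finally have mass1: "ennreal (a x) = emeasure \<gamma> UNIV" .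
      have "(\<integral>\<^sup>+y. ennreal (s y) \<partial>\<nu>) = emeasure (density \<nu> (\<lambda>y. ennreal (s y))) UNIV"
        by (simp add: emeasure_density \<nu>D)
      also have "\<dots> = emeasure \<gamma> UNIV"
        unfolding s_eq by (simp add: emeasure_distr \<gamma>D)
      finally have mass2: "(\<integral>\<^sup>+y. ennreal (s y) \<partial>\<nu>) = ennreal (a x)"
        by (simp add: mass1)
      \<comment> \<open>The first marginal is a multiple of the Dirac measure at \<open>x\<close>,
        so \<open>\<gamma>\<close> lives over \<open>x\<close> and the cost becomes an integral
        against the second marginal.\<close>
      have "emeasure ?\<gamma>1 (- {x}) = emeasure (density (return borel x) (\<lambda>y. ennreal (a y))) (- {x})"
        by (simp add: a_eq)
      also have "\<dots> = 0"
        using a by (simp add: emeasure_density nn_integral_return)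
      finally have "emeasure \<gamma> (fst -` (- {x})) = 0"
        by (simp add: emeasure_distr \<gamma>D)
      moreover have "fst -` (- {x}) \<inter> space \<gamma> \<in> sets \<gamma>"
        by (rule measurable_sets[of fst \<gamma> borel]) measurable
      ultimately have "AE p in \<gamma>. fst p = x"
        by (intro AE_I[of _ _ "fst -` (- {x})"]) (auto simp: \<gamma>D)
      then have "(\<integral>\<^sup>+(x, y). HK_cost \<kappa> x y \<partial>\<gamma>) = (\<integral>\<^sup>+p. neg_log (HK_kernel \<kappa> x (snd p)) \<partial>\<gamma>)"
        by (intro nn_integral_cong_AE) (auto simp: HK_cost_eq_neg_log[OF assms(1)])
      also have "\<dots> = (\<integral>\<^sup>+y. neg_log (HK_kernel \<kappa> x y) \<partial>?\<gamma>2)"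
        by (simp add: nn_integral_distr)
      also have "\<dots> = (\<integral>\<^sup>+y. ennreal (s y) * neg_log (HK_kernel \<kappa> x y) \<partial>\<nu>)"
        unfolding s_eq[symmetric] by (simp add: nn_integral_density)
      finally have cost: "(\<integral>\<^sup>+(x, y). HK_cost \<kappa> x y \<partial>\<gamma>)
          = (\<integral>\<^sup>+y. ennreal (s y) * neg_log (HK_kernel \<kappa> x y) \<partial>\<nu>)" .
      define C where "C = (\<integral>\<^sup>+(x, y). HK_cost \<kappa> x y \<partial>\<gamma>)"
      \<comment> \<open>\<open>P\<close> and \<open>N\<close> are the positive and negative parts of
        \<open>t\<close> times the mass of the plan, which both marginals share.\<close>
      define P where "P = ennreal (max t 0 * a x)"
      define N where "N = ennreal (max (- t) 0 * a x)"
      have "(\<integral>\<^sup>+y. ennreal (max t 0 * s y) + 1 \<partial>\<nu>) \<le>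
        (\<integral>\<^sup>+y. ennreal (s y) * neg_log (HK_kernel \<kappa> x y) + ennreal (entropy_fun (s y))
          + ennreal (exp t * HK_kernel \<kappa> x y) + ennreal (max (- t) 0 * s y) \<partial>\<nu>)"
        by (intro nn_integral_mono neg_log_duality s_nn) auto
      then have 2: "P + emeasure \<nu> UNIV \<le> C + KL_div ?\<gamma>2 \<nu> + ennreal (exp t * ?F) + N"
        using a_nn s_nn
        by (simp add: nn_integral_add nn_integral_cmult ennreal_mult P_def N_def C_def cost KL2
            mass2 ennreal_HK_potential[OF \<nu>] \<nu>D)
      \<comment> \<open>The first marginal is handled by the same pointwise inequality with kernel
        value 1 and dual variable \<open>- t\<close>.\<close>
      have 1: "N + 1 \<le> KL_div ?\<gamma>1 (return borel x) + ennreal (exp (- t)) + P"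
        using neg_log_duality[OF a_nn, of 1 "- t" x] by (simp add: N_def P_def KL1 neg_log_def)
      \<comment> \<open>The two bounds carry \<open>P\<close> and \<open>N\<close> on opposite
        sides, so their sum has \<open>P + N\<close> on both; being finite, it cancels.\<close>
      have "(P + N) + (1 + emeasure \<nu> UNIV)
        \<le> (P + N) + (C + KL_div ?\<gamma>1 (return borel x) + KL_div ?\<gamma>2 \<nu> + R)"
        using add_mono[OF 1 2] by (simp add: R_def ac_simps)
      moreover have "P + N \<noteq> \<top>" by (simp add: P_def N_def)
      ultimately show ?thesis
        unfolding C_def by (simp only: ennreal_add_left_cancel_le) auto
    qed
  qed
  have "1 + emeasure \<nu> UNIV - R \<le> HK_sq \<kappa> (return borel x) \<nu>"
    unfolding HK_sq_def
  proof (rule INF_greatest)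
    fix \<gamma> :: "('a \<times> 'a) measure" assume "\<gamma> \<in> radon_measures"
    from main[OF this] show "1 + emeasure \<nu> UNIV - R \<le> (\<integral>\<^sup>+(x, y). HK_cost \<kappa> x y \<partial>\<gamma>)
      + KL_div (distr \<gamma> borel fst) (return borel x) + KL_div (distr \<gamma> borel snd) \<nu>"
      by (intro ennreal_minus_le_iff[THEN iffD2]) (auto simp: add.commute)
  qed
  then show ?thesis
    by (simp add: R_def ennreal_minus_le_iff add.commute)
qed

text \<open>Minimising \<open>exp t * F + exp (- t)\<close> over \<open>t\<close> gives
  \<open>2 * sqrt F\<close>. For \<open>F = 0\<close> the infimum 0 is not attained, hence the
  separate limit argument with \<open>e = exp (- t)\<close>.\<close>

lemma HK_sq_dirac_ge:
  assumes "0 < \<kappa>" and \<nu>: "\<nu> \<in> radon_measures"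
  shows "ennreal (1 + measure \<nu> UNIV - 2 * sqrt (HK_potential \<kappa> \<nu> x))
    \<le> HK_sq \<kappa> (return borel x) \<nu>"
proof (cases "HK_sq \<kappa> (return borel x) \<nu>")
  case (real h)
  let ?F = "HK_potential \<kappa> \<nu> x" and ?m = "measure \<nu> UNIV"
  have dual: "1 + ?m \<le> h + (exp t * ?F + exp (- t))" for t
  proof -
    have "ennreal (1 + ?m) \<le> ennreal (h + (exp t * ?F + exp (- t)))"
      using HK_sq_dirac_dual[OF assms, of x t] real radon_measuresD(4)[OF \<nu>] by simp
    then show ?thesis using real by (subst (asm) ennreal_le_iff) auto
  qed
  have "1 + ?m - 2 * sqrt ?F \<le> h"
  proof (cases "?F = 0")
    case True
    have "1 + ?m \<le> h + e" if "0 < e" for e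
      using dual[of "- ln e"] that True by simp
    then have "1 + ?m \<le> h" by (rule field_le_epsilon)
    then show ?thesis by (simp add: True)
  next
    case False
    then have F: "0 < ?F" by (simp add: less_le)
    have "exp (- ln (sqrt ?F)) * ?F = sqrt ?F"
      using F by (simp add: exp_minus field_simps)
    then show ?thesis using dual[of "- ln (sqrt ?F)"] F by simp
  qed
  then show ?thesis using real by (simp add: ennreal_leI)
qed simp

text \<open>The plan is read off from equality in the dual bound: its second marginal has density
  \<open>exp t * k\<close> with \<open>exp t = 1 / sqrt F\<close>, and its mass is
  \<open>sqrt F\<close>.\<close>

lemma HK_sq_dirac_le:
  assumes "0 < \<kappa>" and \<nu>: "\<nu> \<in> radon_measures"
  shows "HK_sq \<kappa> (return borel x) \<nu>
    \<le> ennreal (1 + measure \<nu> UNIV - 2 * sqrt (HK_potential \<kappa> \<nu> x))"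
proof -
  note \<nu>D = radon_measuresD[OF \<nu>]
  interpret \<nu>: finite_measure \<nu> by (rule \<nu>D)
  have [measurable_cong]: "sets \<nu> = sets borel" by (rule \<nu>D)
  note [measurable] = borel_measurable_fst_snd borel_measurable_HK_cost[OF assms(1)]
  let ?F = "HK_potential \<kappa> \<nu> x" and ?m = "measure \<nu> UNIV"
  \<comment> \<open>The optimal plan; when the potential vanishes, \<open>1 / 0 = 0\<close> makes it the zero measure.\<close>
  define c where "c = 1 / sqrt ?F"
  define s where "s y = c * HK_kernel \<kappa> x y" for y
  have c: "0 \<le> c" by (simp add: c_def)
  have s_nn: "0 \<le> s y" for y using c by (simp add: s_def)
  have cF: "c * ?F = sqrt ?F" by (simp add: c_def real_div_sqrt)
  have s [measurable]: "s \<in> borel_measurable borel" unfolding s_def[abs_def] by measurable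
  have pair [measurable]: "Pair x \<in> borel_measurable borel"
    by (intro borel_measurable_continuous_onI continuous_intros)
  define \<nu>' where "\<nu>' = density \<nu> (\<lambda>y. ennreal (s y))"
  have [measurable_cong]: "sets \<nu>' = sets borel" by (simp add: \<nu>'_def \<nu>D)
  have sp: "space \<nu>' = UNIV" by (simp add: \<nu>'_def \<nu>D)
  have mass: "emeasure \<nu>' UNIV = ennreal (sqrt ?F)"
    using c by (simp add: \<nu>'_def emeasure_density \<nu>D s_def ennreal_mult nn_integral_cmult
        ennreal_HK_potential[OF \<nu>] flip: cF)
  interpret \<nu>': finite_measure \<nu>' by (rule finite_measureI) (simp add: mass sp)
  define \<gamma> where "\<gamma> = distr \<nu>' borel (Pair x)"
  have \<gamma>: "\<gamma> \<in> radon_measures"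
    by (auto simp: radon_measures_def \<gamma>_def intro!: \<nu>'.finite_measure_distr)
  have finx: "finite_measure (return borel x)"
    by (intro prob_space.finite_measure prob_space_return) simp
  have d1: "density (return borel x) (\<lambda>y. ennreal (sqrt ?F)) = distr \<gamma> borel fst"
  proof (rule measure_eqI)
    fix A assume "A \<in> sets (density (return borel x) (\<lambda>y. ennreal (sqrt ?F)))"
    then have [measurable]: "A \<in> sets borel" by simp
    have "emeasure (distr \<gamma> borel fst) A = emeasure \<nu>' (if x \<in> A then UNIV else {})"
      by (simp add: \<gamma>_def distr_distr comp_def emeasure_distr sp)
    then show "emeasure (density (return borel x) (\<lambda>y. ennreal (sqrt ?F))) A
      = emeasure (distr \<gamma> borel fst) A"
      by (simp add: emeasure_density nn_integral_return mass split: split_indicator)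
  qed simp
  have d2: "density \<nu> (\<lambda>y. ennreal (s y)) = distr \<gamma> borel snd"
    using distr_id2[of borel \<nu>'] by (simp add: \<gamma>_def distr_distr comp_def \<nu>'_def \<nu>D)
  have fin: "finite_measure (distr \<gamma> borel fst)" "finite_measure (distr \<gamma> borel snd)"
    using finite_measure.finite_measure_distr[OF radon_measuresD(3)[OF \<gamma>]]
      measurable_cong_sets[OF radon_measuresD(1)[OF \<gamma>] refl] borel_measurable_fst_snd
    by blast+
  have KL1: "KL_div (distr \<gamma> borel fst) (return borel x) = ennreal (entropy_fun (sqrt ?F))"
    by (subst KL_div_density[OF finx _ _ fin(1) d1]) (simp_all add: nn_integral_return)
  have KL2: "KL_div (distr \<gamma> borel snd) \<nu> = (\<integral>\<^sup>+y. ennreal (entropy_fun (s y)) \<partial>\<nu>)"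
    by (rule KL_div_density[OF \<nu>D(3) _ s_nn fin(2) d2]) measurable
  have cost: "(\<integral>\<^sup>+(x, y). HK_cost \<kappa> x y \<partial>\<gamma>)
      = (\<integral>\<^sup>+y. ennreal (s y) * neg_log (HK_kernel \<kappa> x y) \<partial>\<nu>)"
  proof -
    have "(\<integral>\<^sup>+(x, y). HK_cost \<kappa> x y \<partial>\<gamma>) = (\<integral>\<^sup>+y. HK_cost \<kappa> x y \<partial>\<nu>')"
      unfolding \<gamma>_def by (subst nn_integral_distr) auto
    also have "\<dots> = (\<integral>\<^sup>+y. ennreal (s y) * neg_log (HK_kernel \<kappa> x y) \<partial>\<nu>)"
      unfolding \<nu>'_def HK_cost_eq_neg_log[OF assms(1)] by (subst nn_integral_density) auto
    finally show ?thesis .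
  qed
  \<comment> \<open>Where \<open>s y > 0\<close>, \<open>ln (s y)\<close> is \<open>ln c\<close>
    plus the logarithm of the kernel, and the latter cancels against the cost. What remains is
    affine in \<open>s y\<close> and integrates explicitly.\<close>
  have pw: "ennreal (s y) * neg_log (HK_kernel \<kappa> x y) + ennreal (entropy_fun (s y))
      = ennreal (1 + (ln c - 1) * s y)"
    and pw_nn: "0 \<le> 1 + (ln c - 1) * s y" for y
  proof -
    let ?k = "HK_kernel \<kappa> x y"
    have "ennreal (s y) * neg_log ?k + ennreal (entropy_fun (s y))
      = ennreal (1 + (ln c - 1) * s y) \<and> 0 \<le> 1 + (ln c - 1) * s y"
    proof (cases "s y = 0")
      case True
      then show ?thesis by (simp add: entropy_fun_def)
    next
      case False
      then have pos: "0 < ?k" "0 < c"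
        using c HK_kernel_nonneg[of \<kappa> x y] by (auto simp: s_def less_le)
      have nl: "0 \<le> - ln ?k" using pos by simp
      have eq: "s y * (- ln ?k) + entropy_fun (s y) = 1 + (ln c - 1) * s y"
        using pos by (simp add: entropy_fun_def s_def ln_mult algebra_simps)
      have "0 \<le> s y * (- ln ?k) + entropy_fun (s y)"
        using s_nn[of y] nl by (intro add_nonneg_nonneg mult_nonneg_nonneg entropy_fun_nonneg)
      moreover have "ennreal (s y) * neg_log ?k + ennreal (entropy_fun (s y))
          = ennreal (s y * (- ln ?k) + entropy_fun (s y))"
        using pos
        by (simp only: ennreal_plus[OF mult_nonneg_nonneg[OF s_nn nl] entropy_fun_nonneg[OF s_nn]]
            ennreal_mult[OF s_nn nl]) (simp add: neg_log_def)
      ultimately show ?thesis unfolding eq by simp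
    qed
    then show "ennreal (s y) * neg_log ?k + ennreal (entropy_fun (s y))
      = ennreal (1 + (ln c - 1) * s y)" "0 \<le> 1 + (ln c - 1) * s y" by auto
  qed
  have int: "integrable \<nu> (\<lambda>y. 1 + (ln c - 1) * s y)"
    unfolding s_def using integrable_HK_kernel[OF \<nu>] by simp
  have "(\<integral>\<^sup>+(x, y). HK_cost \<kappa> x y \<partial>\<gamma>) + KL_div (distr \<gamma> borel snd) \<nu>
      = (\<integral>\<^sup>+y. ennreal (1 + (ln c - 1) * s y) \<partial>\<nu>)"
    unfolding cost KL2 by (subst nn_integral_add[symmetric]) (auto simp: pw)
  also have "\<dots> = ennreal (\<integral>y. 1 + (ln c - 1) * s y \<partial>\<nu>)"
    using int pw_nn by (intro nn_integral_eq_integral) auto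
  also have "(\<integral>y. 1 + (ln c - 1) * s y \<partial>\<nu>) = ?m + (ln c - 1) * sqrt ?F"
    using integrable_HK_kernel[OF \<nu>]
    by (simp add: s_def \<nu>D flip: HK_potential_def cF)
  finally have 12: "(\<integral>\<^sup>+(x, y). HK_cost \<kappa> x y \<partial>\<gamma>) + KL_div (distr \<gamma> borel snd) \<nu>
      = ennreal (?m + (ln c - 1) * sqrt ?F)" .
  have nn: "0 \<le> ?m + (ln c - 1) * sqrt ?F"
  proof -
    have "0 \<le> (\<integral>y. 1 + (ln c - 1) * s y \<partial>\<nu>)" using pw_nn by (intro Bochner_Integration.integral_nonneg) auto
    then show ?thesis using integrable_HK_kernel[OF \<nu>]
      by (simp add: s_def \<nu>D flip: HK_potential_def cF)
  qed
  have fin_eq: "?m + (ln c - 1) * sqrt ?F + entropy_fun (sqrt ?F) = 1 + ?m - 2 * sqrt ?F"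
  proof (cases "?F = 0")
    case False
    then have "0 < ?F" by (simp add: less_le)
    then show ?thesis
      by (simp add: entropy_fun_def c_def ln_div algebra_simps)
  qed (simp add: entropy_fun_def)
  have "HK_sq \<kappa> (return borel x) \<nu> \<le> (\<integral>\<^sup>+(x, y). HK_cost \<kappa> x y \<partial>\<gamma>)
       + KL_div (distr \<gamma> borel fst) (return borel x) + KL_div (distr \<gamma> borel snd) \<nu>"
    unfolding HK_sq_def by (rule INF_lower[OF \<gamma>])
  also have "\<dots> = ennreal (?m + (ln c - 1) * sqrt ?F) + ennreal (entropy_fun (sqrt ?F))"
    unfolding 12[symmetric] KL1 by (simp add: ac_simps)
  also have "\<dots> = ennreal (1 + ?m - 2 * sqrt ?F)"
    using nn entropy_fun_nonneg[of "sqrt ?F"] fin_eq by (simp flip: ennreal_plus)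
  finally show ?thesis .
qed

section \<open>The torus and the barycenter functional\<close>

lemma torus_proj_surj: obtains u where "z = torus_proj u"
proof -
  have "\<exists>u. z = torus_proj u"
    by transfer (use equivp_reflp[OF equivp_torus_rel] in blast)
  then show thesis using that by blast
qed

lemma torus_proj_eq_iff: "torus_proj u = torus_proj v \<longleftrightarrow> u - v \<in> int_lattice"
  by transfer (simp add: torus_rel_def)

lemma torus_proj_add_lattice: "l \<in> int_lattice \<Longrightarrow> torus_proj (u + l) = torus_proj u"
  by (simp add: torus_proj_eq_iff)

lemma countable_int_lattice: "countable (int_lattice :: (real ^ 'n::finite) set)"
proof -
  have "int_lattice \<subseteq> range (\<lambda>z :: int ^ 'n. \<chi> i. real_of_int (z $ i))"
  proof
    fix k :: "real ^ 'n" assume "k \<in> int_lattice"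
    then have "k = (\<chi> i. real_of_int ((\<chi> i. \<lfloor>k $ i\<rfloor>) $ i))"
      by (auto simp: int_lattice_def vec_eq_iff)
    then show "k \<in> range (\<lambda>z :: int ^ 'n. \<chi> i. real_of_int (z $ i))"
      by blast
  qed
  then show ?thesis by (rule countable_subset) simp
qed

lemma infdist_int_lattice_le: "l \<in> int_lattice \<Longrightarrow> infdist u int_lattice \<le> norm (u - l)"
  using infdist_le[of l int_lattice u] by (simp add: dist_norm)

lemma infdist_int_lattice_attained:
  fixes u :: "real ^ 'n"
  obtains l where "l \<in> int_lattice" "infdist u int_lattice = norm (u - l)"
  using infdist_attains_inf[OF closed_int_lattice, of u] int_lattice_zero
  by (metis dist_norm empty_iff)

lemma open_map_torus_proj:
  fixes U :: "(real ^ 'n::finite) set"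
  assumes "open U"
  shows "open (torus_proj ` U)"
  unfolding open_dist
proof
  fix z assume "z \<in> torus_proj ` U"
  then obtain u where u: "u \<in> U" "z = torus_proj u" by blast
  then obtain e where e: "0 < e" "ball u e \<subseteq> U" using assms openE by blast
  show "\<exists>e>0. \<forall>y. dist y z < e \<longrightarrow> y \<in> torus_proj ` U"
  proof (intro exI conjI allI impI)
    fix y assume d: "dist y z < e"
    obtain w where w: "y = torus_proj w" by (rule torus_proj_surj)
    obtain l where l: "l \<in> int_lattice" "infdist (w - u) int_lattice = norm (w - u - l)"
      by (rule infdist_int_lattice_attained)
    have "w - l \<in> ball u e"
      using d l by (simp add: w u dist_torus_proj dist_norm norm_minus_commute algebra_simps)
    moreover have "y = torus_proj (w - l)"
      using l by (simp add: w torus_proj_eq_iff)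
    ultimately show "y \<in> torus_proj ` U" using e by blast
  qed fact
qed

text \<open>Identifies the Borel sets of the square of the torus with the product sigma algebra, on
  which Fubini is applied. The basis consists of the images of a countable basis under the open
  projection.\<close>

instance torus :: (finite) second_countable_topology
proof
  obtain B :: "(real ^ 'a) set set" where B: "countable B" "topological_basis B"
    using ex_countable_basis by blast
  have "topological_basis ((`) torus_proj ` B :: 'a torus set set)"
  proof (rule topological_basisI)
    fix V :: "'a torus set" assume "V \<in> (`) torus_proj ` B"
    then show "open V"
      using B open_map_torus_proj topological_basis_open by blast
  next
    fix V :: "'a torus set" and z assume V: "open V" "z \<in> V"
    obtain u where u: "z = torus_proj u" by (rule torus_proj_surj)
    have "open (torus_proj -` V)"
      using V continuous_on_torus_proj by (auto intro: open_vimage)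
    from topological_basisE[OF B(2) this, of u] V u
    obtain W where "W \<in> B" "u \<in> W" "W \<subseteq> torus_proj -` V"
      by blast
    then show "\<exists>W\<in>(`) torus_proj ` B. z \<in> W \<and> W \<subseteq> V"
      by (intro bexI[of _ "torus_proj ` W"]) (auto simp: u)
  qed
  then show "\<exists>B :: 'a torus set set. countable B \<and> open = generate_topology B"
    using countable_image[OF B(1)] topological_basis_imp_subbasis by metis
qed

section \<open>Integration over a cell and translation invariance\<close>

text \<open>Half-open, so that its lattice translates tile the space without overlap; the closed
  cube in \<open>uniform_torus\<close> differs from it by a null set.\<close>

definition unit_cell :: "(real ^ 'n) set" where
  "unit_cell = {x. \<forall>i. 0 \<le> x $ i \<and> x $ i < 1}"

lemma unit_cell_measurable [measurable]: "(unit_cell :: (real ^ 'n::finite) set) \<in> sets borel"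
  unfolding unit_cell_def by measurable

text \<open>Only the vector of floors moves \<open>x\<close> into the cell. An integral over
  counting measure is the form that can be exchanged with the Lebesgue integral.\<close>

lemma unit_cell_translate_unique:
  fixes x :: "real ^ 'n::finite"
  shows "(\<integral>\<^sup>+l. indicator unit_cell (x - l) \<partial>count_space int_lattice) = (1 :: ennreal)"
proof -
  define f where "f = (\<chi> i. real_of_int \<lfloor>x $ i\<rfloor>)"
  have f: "f \<in> int_lattice" by (simp add: f_def int_lattice_def)
  have "x - l \<in> unit_cell \<longleftrightarrow> l = f" if "l \<in> int_lattice" for l
  proof -
    have "0 \<le> x $ i - l $ i \<and> x $ i - l $ i < 1 \<longleftrightarrow> l $ i = real_of_int \<lfloor>x $ i\<rfloor>" for i
    proof -
      have "l $ i \<in> \<int>" using that by (simp add: int_lattice_def)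
      then obtain k where k: "l $ i = of_int k" by (rule Ints_cases)
      have "0 \<le> x $ i - of_int k \<and> x $ i - of_int k < 1 \<longleftrightarrow> \<lfloor>x $ i\<rfloor> = k"
        unfolding floor_eq_iff by linarith
      then show ?thesis by (simp add: k eq_commute)
    qed
    then show ?thesis by (simp add: unit_cell_def vec_eq_iff f_def)
  qed
  then have "(\<integral>\<^sup>+l. indicator unit_cell (x - l) \<partial>count_space int_lattice)
    = (\<integral>\<^sup>+l. indicator {f} l \<partial>count_space int_lattice)"
    by (intro nn_integral_cong) (auto simp: indicator_def)
  also have "\<dots> = 1" using f by simp
  finally show ?thesis .
qed

lemma unit_cell_translate_unique':
  fixes x :: "real ^ 'n::finite"
  shows "(\<integral>\<^sup>+l. indicator unit_cell (x + l) \<partial>count_space int_lattice) = (1 :: ennreal)"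
proof -
  have "bij_betw uminus int_lattice (int_lattice :: (real ^ 'n) set)"
    by (rule bij_betw_byWitness[where f' = uminus]) (auto intro: int_lattice_uminus)
  from nn_integral_bij_count_space[OF this, of "\<lambda>l. indicator unit_cell (x + l)"]
  show ?thesis using unit_cell_translate_unique[of x] by simp
qed

lemma nn_integral_lborel_translate:
  fixes f :: "'a::euclidean_space \<Rightarrow> ennreal"
  assumes [measurable]: "f \<in> borel_measurable borel"
  shows "(\<integral>\<^sup>+x. f (x + c) \<partial>lborel) = (\<integral>\<^sup>+x. f x \<partial>lborel)"
proof -
  have "(\<integral>\<^sup>+x. f x \<partial>lborel) = (\<integral>\<^sup>+x. f x \<partial>distr lborel borel ((+) c))"
    by (simp add: lborel_distr_plus)
  also have "\<dots> = (\<integral>\<^sup>+x. f (x + c) \<partial>lborel)"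
    by (subst nn_integral_distr) (simp_all add: add.commute)
  finally show ?thesis by simp
qed

text \<open>
  Insert the partition of unity given by the lattice translates of the cell and move the
  translations from one indicator to the other.
\<close>

lemma nn_integral_unit_cell_periodic:
  fixes f :: "real ^ 'n::finite \<Rightarrow> ennreal"
  assumes [measurable]: "f \<in> borel_measurable borel"
    and per: "\<And>x l. l \<in> int_lattice \<Longrightarrow> f (x + l) = f x"
  shows "(\<integral>\<^sup>+x. f (x - c) * indicator unit_cell x \<partial>lborel)
    = (\<integral>\<^sup>+x. f x * indicator unit_cell x \<partial>lborel)"
proof -
  let ?Q = "indicator unit_cell :: real ^ 'n \<Rightarrow> ennreal"
  have "(\<integral>\<^sup>+x. f (x - c) * ?Q x \<partial>lborel) = (\<integral>\<^sup>+x. f x * ?Q (x + c) \<partial>lborel)"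
    using nn_integral_lborel_translate[of "\<lambda>x. f (x - c) * ?Q x" c] by simp
  also have "\<dots> = (\<integral>\<^sup>+x. \<integral>\<^sup>+l. f x * ?Q (x + c) * ?Q (x - l) \<partial>count_space int_lattice \<partial>lborel)"
    by (subst nn_integral_cmult) (simp_all add: unit_cell_translate_unique)
  also have "\<dots> = (\<integral>\<^sup>+l. \<integral>\<^sup>+x. f x * ?Q (x + c) * ?Q (x - l) \<partial>lborel \<partial>count_space int_lattice)"
    by (rule nn_integral_count_space_nn_integral[OF countable_int_lattice]) measurable
  also have "\<dots> = (\<integral>\<^sup>+l. \<integral>\<^sup>+x. f x * ?Q x * ?Q (x + c + l) \<partial>lborel \<partial>count_space int_lattice)"
  proof (rule nn_integral_cong)
    fix l :: "real ^ 'n" assume "l \<in> space (count_space int_lattice)"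
    then have "f (x + l) = f x" for x by (simp add: per)
    then show "(\<integral>\<^sup>+x. f x * ?Q (x + c) * ?Q (x - l) \<partial>lborel)
      = (\<integral>\<^sup>+x. f x * ?Q x * ?Q (x + c + l) \<partial>lborel)"
      using nn_integral_lborel_translate[of "\<lambda>x. f x * ?Q (x + c) * ?Q (x - l)" l]
      by (simp add: ac_simps)
  qed
  also have "\<dots> = (\<integral>\<^sup>+x. \<integral>\<^sup>+l. f x * ?Q x * ?Q (x + c + l) \<partial>count_space int_lattice \<partial>lborel)"
    by (rule nn_integral_count_space_nn_integral[OF countable_int_lattice, symmetric]) measurable
  also have "\<dots> = (\<integral>\<^sup>+x. f x * ?Q x \<partial>lborel)"
    by (subst nn_integral_cmult) (simp_all add: unit_cell_translate_unique')
  finally show ?thesis .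
qed

lemma emeasure_unit_cube: "emeasure lborel (cbox 0 1 :: (real ^ 'n::finite) set) = 1"
proof -
  have "1 \<bullet> b = 1" if "b \<in> (Basis :: (real ^ 'n) set)" for b
    using that by (auto simp: Basis_vec_def inner_axis)
  then show ?thesis by (simp add: emeasure_lborel_cbox)
qed

lemma prob_space_uniform_torus: "prob_space (uniform_torus :: 'n::finite torus measure)"
  unfolding uniform_torus_def
  by (intro prob_space.prob_space_distr prob_space_uniform_measure)
     (auto simp: emeasure_unit_cube)

lemma uniform_torus_radon: "uniform_torus \<in> radon_measures"
  using prob_space.finite_measure[OF prob_space_uniform_torus]
  by (simp add: radon_measures_def uniform_torus_def)

lemma nn_integral_uniform_torus:
  fixes f :: "'n::finite torus \<Rightarrow> ennreal"
  assumes [measurable]: "f \<in> borel_measurable borel"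
  shows "(\<integral>\<^sup>+x. f x \<partial>uniform_torus) = (\<integral>\<^sup>+u. f (torus_proj u) * indicator unit_cell u \<partial>lborel)"
proof -
  have "(\<integral>\<^sup>+x. f x \<partial>uniform_torus)
      = (\<integral>\<^sup>+u. f (torus_proj u) * indicator (cbox 0 1) u \<partial>lborel)"
    unfolding uniform_torus_def
    by (simp add: nn_integral_distr nn_integral_uniform_measure emeasure_unit_cube divide_ennreal_def)
  also have "\<dots> = (\<integral>\<^sup>+u. f (torus_proj u) * indicator unit_cell u \<partial>lborel)"
  proof (rule nn_integral_cong_AE)
    have "AE u in lborel. u \<notin> cbox 0 1 - box 0 (1 :: real ^ 'n)"
    proof (intro AE_not_in null_setsI)
      have "emeasure lborel (box 0 1 :: (real ^ 'n) set) = emeasure lborel (cbox 0 (1 :: real ^ 'n))"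
        by (simp add: emeasure_lborel_box_eq emeasure_lborel_cbox_eq)
      then show "emeasure lborel (cbox 0 1 - box 0 (1 :: real ^ 'n)) = 0"
        by (subst emeasure_Diff) (simp_all add: box_subset_cbox emeasure_unit_cube)
    qed simp
    then show "AE u in lborel. f (torus_proj u) * indicator (cbox 0 1) u
        = f (torus_proj u) * indicator unit_cell u"
    proof eventually_elim
      case (elim u)
      then have "u \<in> cbox 0 1 \<longleftrightarrow> u \<in> unit_cell"
        by (auto simp: unit_cell_def mem_box_cart less_imp_le)
      then show ?case by (simp add: indicator_def)
    qed
  qed
  finally show ?thesis .
qed

lemma HK_kernel_torus_proj:
  "HK_kernel \<kappa> (torus_proj u) (torus_proj v) = trunc_cos_sq (infdist (u - v) int_lattice / \<kappa>)"
  by (simp add: HK_kernel_def dist_torus_proj)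

text \<open>The kernel is even and depends only on the difference of lifts, so the choice of point
  is a translation, invisible to the integral of a periodic function over a cell.\<close>

lemma HK_potential_uniform_torus_const:
  fixes x y :: "'n::finite torus"
  shows "HK_potential \<kappa> uniform_torus x = HK_potential \<kappa> uniform_torus y"
proof -
  have "ennreal (HK_potential \<kappa> uniform_torus (torus_proj v :: 'n torus))
    = (\<integral>\<^sup>+u. ennreal (HK_kernel \<kappa> (torus_proj u) (torus_proj (0 :: real ^ 'n))) * indicator unit_cell u \<partial>lborel)" for v
  proof -
    let ?k = "\<lambda>u. ennreal (HK_kernel \<kappa> (torus_proj u) (torus_proj (0 :: real ^ 'n)))"
    have "ennreal (HK_potential \<kappa> uniform_torus (torus_proj v :: 'n torus))
        = (\<integral>\<^sup>+y. ennreal (HK_kernel \<kappa> (torus_proj v) y) \<partial>uniform_torus)"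
      by (rule ennreal_HK_potential[OF uniform_torus_radon, symmetric])
    also have "\<dots> = (\<integral>\<^sup>+u. ennreal (HK_kernel \<kappa> (torus_proj v) (torus_proj u)) * indicator unit_cell u \<partial>lborel)"
      by (rule nn_integral_uniform_torus) measurable
    also have "\<dots> = (\<integral>\<^sup>+u. ?k (u - v) * indicator unit_cell u \<partial>lborel)"
    proof -
      have "HK_kernel \<kappa> (torus_proj v) (torus_proj u) = HK_kernel \<kappa> (torus_proj (u - v)) (torus_proj 0)" for u
        using infdist_int_lattice_uminus[of "u - v"] by (simp add: HK_kernel_torus_proj)
      then show ?thesis by simp
    qed
    also have "\<dots> = (\<integral>\<^sup>+u. ?k u * indicator unit_cell u \<partial>lborel)"
    proof (rule nn_integral_unit_cell_periodic)
      have "(\<lambda>u. HK_kernel \<kappa> (torus_proj u) (torus_proj (0 :: real ^ 'n))) \<in> borel_measurable borel"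
        by (intro borel_measurable_continuous_onI continuous_intros continuous_on_torus_proj)
      then show "?k \<in> borel_measurable borel" by measurable
    qed (simp add: torus_proj_add_lattice)
    finally show ?thesis .
  qed
  note eq = this
  obtain u where u: "x = torus_proj u" by (rule torus_proj_surj)
  obtain v where v: "y = torus_proj v" by (rule torus_proj_surj)
  have "ennreal (HK_potential \<kappa> uniform_torus x) = ennreal (HK_potential \<kappa> uniform_torus y)"
    unfolding u v eq ..
  then show ?thesis by simp
qed

text \<open>The uniform measure has full support: an open null set cannot meet the open cube, and
  continuity carries the equality to the closed cube, which contains a lift of every point.\<close>

lemma AE_uniform_torus_continuous_const:
  fixes f :: "'n::finite torus \<Rightarrow> real"
  assumes cont: "continuous_on UNIV f" and ae: "AE x in uniform_torus. f x = c"
  shows "f x = c"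
proof -
  have [measurable]: "f \<in> borel_measurable borel"
    using cont by (rule borel_measurable_continuous_onI)
  define g where "g u = f (torus_proj u)" for u
  have g: "continuous_on UNIV g" unfolding g_def[abs_def]
    by (rule continuous_on_compose2[OF cont continuous_on_torus_proj]) simp
  define V where "V = {u. g u \<noteq> c}"
  have V: "open V" unfolding V_def using g by (intro open_Collect_neq continuous_on_const)
  have "(\<integral>\<^sup>+x. indicator {x. f x \<noteq> c} x \<partial>uniform_torus) = 0"
    using ae by (subst nn_integral_0_iff_AE) (auto simp: uniform_torus_def)
  then have "(\<integral>\<^sup>+u. indicator {x. f x \<noteq> c} (torus_proj u) * indicator unit_cell u \<partial>lborel) = 0"
    by (subst (asm) nn_integral_uniform_torus) simp_all
  moreover have "(\<integral>\<^sup>+u. indicator (V \<inter> box 0 1) u \<partial>lborel)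
     \<le> (\<integral>\<^sup>+u. indicator {x. f x \<noteq> c} (torus_proj u) * indicator unit_cell u \<partial>lborel)"
    by (intro nn_integral_mono)
       (auto simp: indicator_def V_def g_def unit_cell_def mem_box_cart less_imp_le)
  ultimately have "emeasure lborel (V \<inter> box 0 1) = 0"
    using V by simp
  then have "V \<inter> box 0 1 \<in> null_sets lborel" using V by auto
  then have "V \<inter> box 0 1 = {}"
    using V open_not_negligible[of "V \<inter> box 0 1"]
    by (auto simp: negligible_iff_null_sets null_sets_completionI)
  then have "g u = c" if "u \<in> box 0 1" for u using that by (auto simp: V_def)
  moreover have "box 0 (1 :: real ^ 'n) \<noteq> {}" by (auto simp: box_ne_empty Basis_vec_def inner_axis)
  ultimately have gc: "g u = c" if "u \<in> cbox 0 1" for u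
    using continuous_constant_on_closure[of "box 0 1" g c u] that continuous_on_subset[OF g]
    by (simp add: closure_box)
  obtain u where u: "x = torus_proj u" by (rule torus_proj_surj)
  define l where "l = (\<chi> i. real_of_int \<lfloor>u $ i\<rfloor>)"
  have "l \<in> int_lattice" by (simp add: l_def int_lattice_def)
  then have "x = torus_proj (u - l)" by (simp add: u torus_proj_eq_iff)
  moreover have "u - l \<in> cbox 0 1"
    by (simp add: l_def mem_box_cart flip: frac_def) (simp add: frac_lt_1 less_imp_le)
  ultimately show ?thesis using gc by (simp add: g_def)
qed

text \<open>A vanishing integral would make the continuous kernel vanish everywhere, yet it is 1 on
  the diagonal.\<close>

lemma HK_potential_uniform_torus_pos:
  assumes "0 < \<kappa>"
  shows "0 < HK_potential \<kappa> uniform_torus (x :: 'n::finite torus)"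
proof (rule ccontr)
  assume "\<not> 0 < HK_potential \<kappa> uniform_torus x"
  then have "(\<integral>y. HK_kernel \<kappa> x y \<partial>uniform_torus) = 0"
    using HK_potential_nonneg[of \<kappa> uniform_torus x] by (simp add: HK_potential_def less_le)
  then have "AE y in uniform_torus. HK_kernel \<kappa> x y = 0"
    by (subst (asm) integral_nonneg_eq_0_iff_AE) (auto simp: integrable_HK_kernel uniform_torus_radon)
  moreover have "continuous_on UNIV (HK_kernel \<kappa> x)" by (intro continuous_intros)
  ultimately have "HK_kernel \<kappa> x x = 0" using AE_uniform_torus_continuous_const by blast
  then show False by (simp add: HK_kernel_def trunc_cos_sq_def)
qed

section \<open>The functional and its minimisers\<close>

text \<open>Fubini and symmetry of the kernel: integrating out \<open>x\<close> first leaves the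
  potential of the uniform measure, the same number for every \<open>y\<close>.\<close>

lemma integral_HK_potential:
  fixes z :: "'n::finite torus" and \<nu> :: "'n torus measure"
  assumes "0 < \<kappa>" and \<nu>: "\<nu> \<in> radon_measures"
  shows "integrable uniform_torus (HK_potential \<kappa> \<nu>)"
    and "(\<integral>x. HK_potential \<kappa> \<nu> x \<partial>uniform_torus)
      = HK_potential \<kappa> uniform_torus z * measure \<nu> UNIV"
proof -
  note \<nu>D = radon_measuresD[OF \<nu>]
  let ?\<rho> = "uniform_torus :: 'n torus measure"
  interpret \<rho>: prob_space ?\<rho> by (rule prob_space_uniform_torus)
  interpret \<nu>: finite_measure \<nu> by (rule \<nu>D)
  interpret pair_sigma_finite ?\<rho> \<nu> ..
  have [measurable_cong]: "sets \<nu> = sets borel" "sets ?\<rho> = sets borel"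
    using \<nu>D radon_measuresD[OF uniform_torus_radon] by auto
  have [measurable]: "HK_potential \<kappa> \<nu> \<in> borel_measurable borel"
    by (intro borel_measurable_continuous_onI continuous_on_HK_potential assms)
  show int: "integrable ?\<rho> (HK_potential \<kappa> \<nu>)"
    by (rule \<rho>.integrable_const_bound[of _ "measure \<nu> UNIV"])
       (auto intro!: HK_potential_le_mass assms)
  have "(\<lambda>p :: 'n torus \<times> 'n torus. HK_kernel \<kappa> (fst p) (snd p)) \<in> borel_measurable (borel \<Otimes>\<^sub>M borel)"
    unfolding borel_prod by (intro borel_measurable_continuous_onI continuous_intros)
  then have meas: "(\<lambda>(x, y). ennreal (HK_kernel \<kappa> x y)) \<in> borel_measurable (?\<rho> \<Otimes>\<^sub>M \<nu>)"
    by (simp add: split_beta')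
  have "ennreal (\<integral>x. HK_potential \<kappa> \<nu> x \<partial>?\<rho>) = (\<integral>\<^sup>+x. \<integral>\<^sup>+y. ennreal (HK_kernel \<kappa> x y) \<partial>\<nu> \<partial>?\<rho>)"
    unfolding ennreal_HK_potential[OF \<nu>] by (rule nn_integral_eq_integral[symmetric, OF int]) simp
  also have "\<dots> = (\<integral>\<^sup>+y. \<integral>\<^sup>+x. ennreal (HK_kernel \<kappa> x y) \<partial>?\<rho> \<partial>\<nu>)"
    by (rule Fubini'[symmetric, OF meas])
  also have "\<dots> = (\<integral>\<^sup>+y. ennreal (HK_potential \<kappa> ?\<rho> z) \<partial>\<nu>)"
  proof (rule nn_integral_cong)
    fix y
    have "(\<integral>\<^sup>+x. ennreal (HK_kernel \<kappa> x y) \<partial>?\<rho>) = (\<integral>\<^sup>+x. ennreal (HK_kernel \<kappa> y x) \<partial>?\<rho>)"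
      by (intro nn_integral_cong arg_cong[of _ _ ennreal] HK_kernel_commute)
    also have "\<dots> = ennreal (HK_potential \<kappa> ?\<rho> y)"
      by (rule ennreal_HK_potential[OF uniform_torus_radon])
    also have "\<dots> = ennreal (HK_potential \<kappa> ?\<rho> z)"
      by (rule arg_cong[OF HK_potential_uniform_torus_const])
    finally show "(\<integral>\<^sup>+x. ennreal (HK_kernel \<kappa> x y) \<partial>?\<rho>) = ennreal (HK_potential \<kappa> ?\<rho> z)" .
  qed
  also have "\<dots> = ennreal (HK_potential \<kappa> ?\<rho> z * measure \<nu> UNIV)"
    by (simp add: \<nu>D ennreal_mult)
  finally show "(\<integral>x. HK_potential \<kappa> \<nu> x \<partial>?\<rho>) = HK_potential \<kappa> ?\<rho> z * measure \<nu> UNIV"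
    by (subst (asm) ennreal_inj) (auto intro!: Bochner_Integration.integral_nonneg)
qed

text \<open>AM-GM: completing the square in \<open>sqrt F\<close> at its mean value.\<close>

lemma HK_objective_uniform_torus:
  fixes z :: "'n::finite torus" and \<nu> :: "'n torus measure"
  assumes "0 < \<kappa>" and \<nu>: "\<nu> \<in> radon_measures"
  defines "K \<equiv> HK_potential \<kappa> uniform_torus z"
  defines "D \<equiv> (\<integral>x. (sqrt (HK_potential \<kappa> \<nu> x) - K)\<^sup>2 \<partial>uniform_torus)"
  shows "HK_objective \<kappa> uniform_torus \<nu> = ennreal (1 - K + D / K)"
    and "0 \<le> 1 - K + D / K"
proof -
  note \<nu>D = radon_measuresD[OF \<nu>]
  let ?\<rho> = "uniform_torus :: 'n torus measure" and ?F = "HK_potential \<kappa> \<nu>" and ?m = "measure \<nu> UNIV"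
  interpret \<rho>: prob_space ?\<rho> by (rule prob_space_uniform_torus)
  have K: "0 < K" unfolding K_def by (rule HK_potential_uniform_torus_pos[OF assms(1)])
  have [measurable_cong]: "sets ?\<rho> = sets borel"
    using radon_measuresD[OF uniform_torus_radon] by auto
  have [measurable]: "?F \<in> borel_measurable borel"
    by (intro borel_measurable_continuous_onI continuous_on_HK_potential assms)
  note F = integral_HK_potential(1)[OF assms(1,2)]
    integral_HK_potential(2)[OF assms(1,2), of z, folded K_def]
  have sq: "integrable ?\<rho> (\<lambda>x. sqrt (?F x))"
    by (rule \<rho>.integrable_const_bound[of _ "sqrt ?m"])
       (auto intro!: HK_potential_le_mass assms)
  have D: "D = K * ?m - 2 * K * (\<integral>x. sqrt (?F x) \<partial>?\<rho>) + K\<^sup>2"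
  proof -
    have "D = (\<integral>x. ?F x - 2 * K * sqrt (?F x) + K\<^sup>2 \<partial>?\<rho>)"
      unfolding D_def by (intro Bochner_Integration.integral_cong) (auto simp: power2_diff)
    then show ?thesis using F sq by (simp add: \<rho>.prob_space)
  qed
  \<comment> \<open>Ensures that \<open>ennreal\<close> truncates nothing; it combines
    \<open>?F x \<le> ?m\<close> with the square of \<open>sqrt (?F x) - 1\<close>.\<close>
  have pos: "0 \<le> 1 + ?m - 2 * sqrt (?F x)" for x
  proof -
    have "2 * sqrt (?F x) \<le> 1 + ?F x"
      using sum_power2_ge_zero[of "sqrt (?F x) - 1" 0] by (simp add: power2_diff)
    then show ?thesis using HK_potential_le_mass[OF \<nu>, of \<kappa> x] by linarith
  qed
  have "(\<integral>x. 1 + ?m - 2 * sqrt (?F x) \<partial>?\<rho>) = 1 + ?m - 2 * (\<integral>x. sqrt (?F x) \<partial>?\<rho>)"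
    using sq by (simp add: \<rho>.prob_space)
  also have "\<dots> = 1 - K + D / K"
    using K by (simp add: D field_simps power2_eq_square)
  finally have eq: "(\<integral>x. 1 + ?m - 2 * sqrt (?F x) \<partial>?\<rho>) = 1 - K + D / K" .
  have "HK_objective \<kappa> ?\<rho> \<nu> = (\<integral>\<^sup>+x. ennreal (1 + ?m - 2 * sqrt (?F x)) \<partial>?\<rho>)"
    unfolding HK_objective_def
    by (intro nn_integral_cong antisym HK_sq_dirac_ge HK_sq_dirac_le assms)
  also have "\<dots> = ennreal (\<integral>x. 1 + ?m - 2 * sqrt (?F x) \<partial>?\<rho>)"
    using sq pos by (intro nn_integral_eq_integral) auto
  finally show "HK_objective \<kappa> ?\<rho> \<nu> = ennreal (1 - K + D / K)" by (simp add: eq)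
  show "0 \<le> 1 - K + D / K"
    unfolding eq[symmetric] using pos by (intro Bochner_Integration.integral_nonneg)
qed

lemma scale_radon_measures:
  assumes \<nu>: "\<nu> \<in> radon_measures" and "0 \<le> c"
  shows "scale_measure (ennreal c) \<nu> \<in> radon_measures"
    and "HK_potential \<kappa> (scale_measure (ennreal c) \<nu>) x = c * HK_potential \<kappa> \<nu> x"
proof -
  show s: "scale_measure (ennreal c) \<nu> \<in> radon_measures"
    using radon_measuresD[OF \<nu>]
    by (auto simp: radon_measures_def ennreal_mult_eq_top_iff space_scale_measure
        intro!: finite_measureI)
  have "HK_kernel \<kappa> x \<in> borel_measurable \<nu>"
    using radon_measuresD(1)[OF \<nu>] measurable_cong_sets borel_measurable_HK_kernel by blast
  then have "(\<integral>\<^sup>+y. ennreal (HK_kernel \<kappa> x y) \<partial>scale_measure (ennreal c) \<nu>)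
      = ennreal c * (\<integral>\<^sup>+y. ennreal (HK_kernel \<kappa> x y) \<partial>\<nu>)"
    by (intro nn_integral_scale_measure measurable_compose[OF _ measurable_ennreal])
  then have "ennreal (HK_potential \<kappa> (scale_measure (ennreal c) \<nu>) x) = ennreal (c * HK_potential \<kappa> \<nu> x)"
    using assms by (simp add: ennreal_HK_potential[OF s] ennreal_HK_potential[OF \<nu>] ennreal_mult)
  then show "HK_potential \<kappa> (scale_measure (ennreal c) \<nu>) x = c * HK_potential \<kappa> \<nu> x"
    using assms by simp
qed

lemma HK_barycenter_uniform_torus_iff:
  fixes \<nu> :: "'n::finite torus measure"
  assumes "0 < \<kappa>"
  shows "HK_barycenter \<kappa> uniform_torus \<nu> \<longleftrightarrow> \<nu> \<in> radon_measures \<and>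
    (\<forall>x. HK_potential \<kappa> \<nu> x = (HK_potential \<kappa> uniform_torus x)\<^sup>2)"
proof -
  define K where "K = HK_potential \<kappa> uniform_torus (undefined :: 'n torus)"
  have K: "0 < K" unfolding K_def by (rule HK_potential_uniform_torus_pos[OF assms])
  have Kx: "HK_potential \<kappa> uniform_torus x = K" for x :: "'n torus"
    unfolding K_def by (rule HK_potential_uniform_torus_const)
  let ?D = "\<lambda>\<nu>. \<integral>x. (sqrt (HK_potential \<kappa> \<nu> x) - K)\<^sup>2 \<partial>(uniform_torus :: 'n torus measure)"
  note J = HK_objective_uniform_torus[OF assms, where z = "undefined :: 'n torus", folded K_def]
  have D_nn: "0 \<le> ?D \<mu>" for \<mu> by (intro Bochner_Integration.integral_nonneg) auto
  show ?thesis
  proof (intro iffI conjI allI)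
    assume bary: "HK_barycenter \<kappa> uniform_torus \<nu>"
    then show \<nu>: "\<nu> \<in> radon_measures" by (simp add: HK_barycenter_def)
    \<comment> \<open>A competitor attaining the lower bound \<open>1 - K\<close>: the uniform
      measure scaled so that its potential is \<open>K * K\<close>.\<close>
    let ?\<mu> = "scale_measure (ennreal K) (uniform_torus :: 'n torus measure)"
    have \<rho>: "(uniform_torus :: 'n torus measure) \<in> radon_measures" by (rule uniform_torus_radon)
    have \<mu>: "?\<mu> \<in> radon_measures" "HK_potential \<kappa> ?\<mu> x = K\<^sup>2" for x
      using scale_radon_measures[OF \<rho>, of K] K Kx by (auto simp: power2_eq_square)
    have "HK_objective \<kappa> uniform_torus \<nu> \<le> HK_objective \<kappa> uniform_torus ?\<mu>"
      using bary \<mu>(1) by (simp add: HK_barycenter_def)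
    then have "1 - K + ?D \<nu> / K \<le> 1 - K + ?D ?\<mu> / K"
      unfolding J(1)[OF \<nu>] J(1)[OF \<mu>(1)] by (subst (asm) ennreal_le_iff) (auto intro!: J(2)[OF \<mu>(1)])
    also have "?D ?\<mu> = 0" using K by (simp add: \<mu>(2))
    finally have "?D \<nu> = 0" using K D_nn[of \<nu>] by (simp add: divide_le_0_iff)
    interpret \<rho>: prob_space "uniform_torus :: 'n torus measure" by (rule prob_space_uniform_torus)
    have [measurable_cong]: "sets (uniform_torus :: 'n torus measure) = sets borel"
      using radon_measuresD[OF uniform_torus_radon] by auto
    have cont: "continuous_on UNIV (\<lambda>x. (sqrt (HK_potential \<kappa> \<nu> x) - K)\<^sup>2)"
      by (intro continuous_intros continuous_on_HK_potential assms \<nu>)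
    have [measurable]: "HK_potential \<kappa> \<nu> \<in> borel_measurable borel"
      by (intro borel_measurable_continuous_onI continuous_on_HK_potential assms \<nu>)
    have "\<bar>sqrt (HK_potential \<kappa> \<nu> x) - K\<bar> \<le> sqrt (measure \<nu> UNIV) + K" for x
    proof -
      have "sqrt (HK_potential \<kappa> \<nu> x) \<le> sqrt (measure \<nu> UNIV)" "0 \<le> sqrt (HK_potential \<kappa> \<nu> x)"
        using HK_potential_le_mass[OF \<nu>] by auto
      then show ?thesis using K by linarith
    qed
    then have "integrable uniform_torus (\<lambda>x. (sqrt (HK_potential \<kappa> \<nu> x) - K)\<^sup>2)"
      by (intro \<rho>.integrable_const_bound[of _ "(sqrt (measure \<nu> UNIV) + K)\<^sup>2"])
         (auto intro!: abs_le_square_iff[THEN iffD1] simp: K less_imp_le)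
    then have "AE x in uniform_torus. (sqrt (HK_potential \<kappa> \<nu> x) - K)\<^sup>2 = 0"
      using \<open>?D \<nu> = 0\<close> by (subst (asm) integral_nonneg_eq_0_iff_AE) auto
    from AE_uniform_torus_continuous_const[OF cont this]
    have "sqrt (HK_potential \<kappa> \<nu> x) = K" for x by simp
    then show "HK_potential \<kappa> \<nu> x = (HK_potential \<kappa> uniform_torus x)\<^sup>2" for x
      by (metis Kx HK_potential_nonneg real_sqrt_pow2)
  next
    assume R: "\<nu> \<in> radon_measures \<and> (\<forall>x. HK_potential \<kappa> \<nu> x = (HK_potential \<kappa> uniform_torus x)\<^sup>2)"
    then have \<nu>: "\<nu> \<in> radon_measures" and "?D \<nu> = 0"
      using K by (auto simp: Kx)
    show "HK_barycenter \<kappa> uniform_torus \<nu>"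
      unfolding HK_barycenter_def
    proof (intro conjI ballI \<nu>)
      fix \<mu> :: "'n torus measure" assume \<mu>: "\<mu> \<in> radon_measures"
      have "1 - K + ?D \<nu> / K \<le> 1 - K + ?D \<mu> / K"
        using K D_nn[of \<mu>] by (simp add: \<open>?D \<nu> = 0\<close>)
      then show "HK_objective \<kappa> uniform_torus \<nu> \<le> HK_objective \<kappa> uniform_torus \<mu>"
        unfolding J(1)[OF \<nu>] J(1)[OF \<mu>] by (rule ennreal_leI)
    qed
  qed
qed

section \<open>Second differences of a radial bump\<close>

text \<open>Covers the places where the chain rule through the norm fails: the origin, where the
  norm is not differentiable, and the edge of the bump, where two branches meet.\<close>

lemma has_derivative_0_of_quadratic:
  fixes f :: "'a::real_normed_vector \<Rightarrow> real"
  assumes "\<And>w. \<bar>f (z + w) - f z\<bar> \<le> (norm w)\<^sup>2"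
  shows "(f has_derivative (\<lambda>_. 0)) (at z)"
  unfolding has_derivative_at
proof (intro conjI bounded_linear_zero)
  show "(\<lambda>h. norm (f (z + h) - f z - 0) / norm h) \<midarrow>0\<rightarrow> 0"
  proof (rule tendsto_sandwich[OF _ _ tendsto_const])
    show "\<forall>\<^sub>F h in at 0. 0 \<le> norm (f (z + h) - f z - 0) / norm h" by simp
    have "norm (f (z + h) - f z - 0) / norm h \<le> norm h" for h
      using assms[of h] by (cases "h = 0") (simp_all add: divide_le_eq power2_eq_square)
    then show "\<forall>\<^sub>F h in at 0. norm (f (z + h) - f z - 0) / norm h \<le> norm h" by simp
    show "(norm \<longlongrightarrow> 0) (at (0 :: 'a))" by (rule tendsto_norm_zero) simp
  qed
qed

definition radial_bump :: "'a::real_inner \<Rightarrow> real" where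
  "radial_bump z = trunc_cos_sq (norm z)"

text \<open>\<open>- sin (2 * r)\<close> is the derivative of the squared cosine. Capping
  \<open>r\<close> at \<open>pi / 2\<close> makes it 0 from the edge on, and
  \<open>sgn 0 = 0\<close> gives the right value at the centre.\<close>

definition radial_bump_grad :: "'a::real_inner \<Rightarrow> 'a" where
  "radial_bump_grad z = - sin (2 * min (norm z) (pi / 2)) *\<^sub>R sgn z"

lemma radial_bump_nonneg [simp]: "0 \<le> radial_bump z"
  by (simp add: radial_bump_def)

lemma radial_bump_uminus: "radial_bump (- z) = radial_bump z"
  by (simp add: radial_bump_def)

lemma radial_bump_outside: "pi / 2 \<le> norm z \<Longrightarrow> radial_bump z = 0"
  by (simp add: radial_bump_def trunc_cos_sq_outside)

lemma trunc_cos_sq_ge: "1 - s\<^sup>2 \<le> trunc_cos_sq s"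
proof -
  let ?m = "min \<bar>s\<bar> (pi / 2)"
  have "(sin ?m)\<^sup>2 \<le> ?m\<^sup>2"
    using abs_sin_x_le_abs_x[of ?m] abs_le_square_iff by blast
  also have "\<dots> \<le> s\<^sup>2" by (auto simp: min_def abs_le_square_iff[symmetric])
  finally show ?thesis by (simp add: trunc_cos_sq_def cos_squared_eq)
qed

text \<open>Inside, \<open>cos r = sin (pi / 2 - r)\<close> is at most the distance to the edge.
  Here \<open>s\<close> is the norm of a base point on or beyond the edge.\<close>

lemma trunc_cos_sq_le_near_edge:
  assumes "0 \<le> r" "pi / 2 \<le> s"
  shows "trunc_cos_sq r \<le> (r - s)\<^sup>2"
proof (cases "r \<le> pi / 2")
  case True
  have "\<bar>cos r\<bar> \<le> \<bar>pi / 2 - r\<bar>"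
    using abs_sin_x_le_abs_x[of "pi / 2 - r"] by (simp add: sin_diff)
  also have "\<dots> \<le> \<bar>r - s\<bar>" using True assms by simp
  finally have "(cos r)\<^sup>2 \<le> (r - s)\<^sup>2" by (simp only: abs_le_square_iff)
  then show ?thesis using True assms by (simp add: trunc_cos_sq_inside)
next
  case False
  then show ?thesis by (simp add: trunc_cos_sq_outside)
qed

lemma has_derivative_radial_bump:
  "(radial_bump has_derivative (\<lambda>v. radial_bump_grad z \<bullet> v)) (at z)"
proof -
  consider "z = 0" | "pi / 2 \<le> norm z" | "z \<noteq> 0" "norm z < pi / 2" by linarith
  then show ?thesis
  proof cases
    case 1
    have "(radial_bump has_derivative (\<lambda>_. 0)) (at z)"
    proof (rule has_derivative_0_of_quadratic)
      fix w :: 'a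
      have "1 - (norm w)\<^sup>2 \<le> radial_bump w" "radial_bump w \<le> 1"
        unfolding radial_bump_def by (rule trunc_cos_sq_ge trunc_cos_sq_le_1)+
      moreover have "radial_bump z = 1" by (simp add: radial_bump_def trunc_cos_sq_def 1)
      ultimately show "\<bar>radial_bump (z + w) - radial_bump z\<bar> \<le> (norm w)\<^sup>2" by (simp add: 1)
    qed
    then show ?thesis by (simp add: 1 radial_bump_grad_def)
  next
    case 2
    have "(radial_bump has_derivative (\<lambda>_. 0)) (at z)"
    proof (rule has_derivative_0_of_quadratic)
      fix w
      have "radial_bump (z + w) \<le> (norm (z + w) - norm z)\<^sup>2"
        unfolding radial_bump_def by (rule trunc_cos_sq_le_near_edge) (use 2 in auto)
      also have "\<dots> \<le> (norm w)\<^sup>2"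
        using norm_triangle_ineq3[of "z + w" z] by (simp add: abs_le_square_iff[symmetric])
      finally show "\<bar>radial_bump (z + w) - radial_bump z\<bar> \<le> (norm w)\<^sup>2"
        using 2 by (simp add: radial_bump_outside)
    qed
    moreover have "radial_bump_grad z = 0" using 2 by (simp add: radial_bump_grad_def min_absorb2)
    ultimately show ?thesis by simp
  next
    case 3
    have "((\<lambda>z. (cos (norm z))\<^sup>2) has_derivative (\<lambda>v. radial_bump_grad z \<bullet> v)) (at z)"
      using 3 by (auto intro!: derivative_eq_intros has_derivative_norm
          simp: radial_bump_grad_def min_absorb1 less_imp_le sin_double inner_commute fun_eq_iff)
    then show ?thesis
    proof (rule has_derivative_transform_within_open[of _ _ _ _ "{z. norm z < pi / 2}"])
      show "open {z :: 'a. norm z < pi / 2}" by (intro open_Collect_less continuous_intros)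
    qed (use 3 in \<open>auto simp: radial_bump_def trunc_cos_sq_inside\<close>)
  qed
qed

text \<open>The constant is 4 + 2: with the gradient written as
  \<open>P (norm z) *\<^sub>R sgn z\<close>, changing the direction costs 4 and changing the radius
  costs 2. The factor \<open>P (norm z)\<close>, at most \<open>2 * norm z\<close>, compensates for
  the singularity of \<open>sgn\<close> at 0.\<close>

lemma radial_bump_grad_lipschitz:
  "norm (radial_bump_grad z - radial_bump_grad w) \<le> 6 * norm (z - w)"
proof (induction "norm z" "norm w" arbitrary: z w rule: linorder_wlog)
  case (sym z w)
  then show ?case by (metis norm_minus_commute)
next
  case (le z w)
  define P where "P r = - sin (2 * min r (pi / 2))" for r :: real
  have min_diff: "\<bar>min r c - min s c\<bar> \<le> \<bar>r - s\<bar>" for r s c :: real by (auto simp: min_def)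
  have P_diff: "\<bar>P r - P s\<bar> \<le> 2 * \<bar>r - s\<bar>" for r s
  proof -
    have "\<bar>P r - P s\<bar> \<le> \<bar>2 * min s (pi / 2) - 2 * min r (pi / 2)\<bar>"
      using sin_diff_le[of "2 * min s (pi / 2)" "2 * min r (pi / 2)"] by (simp add: P_def)
    also have "\<dots> = 2 * \<bar>min s (pi / 2) - min r (pi / 2)\<bar>"
      by (simp only: right_diff_distrib[symmetric] abs_mult abs_numeral)
    also have "\<dots> \<le> 2 * \<bar>r - s\<bar>" using min_diff[of s "pi / 2" r] by (simp add: abs_minus_commute)
    finally show ?thesis .
  qed
  have P_le: "\<bar>P (norm z)\<bar> \<le> 2 * norm z"
    using P_diff[of "norm z" 0] by (simp add: P_def)
  have "norm (P (norm z) *\<^sub>R (sgn z - sgn w)) \<le> 4 * norm (z - w)"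
  proof (cases "w = 0")
    case True
    then show ?thesis using le by simp
  next
    case False
    have "norm (P (norm z) *\<^sub>R (sgn z - sgn w)) \<le> 2 * norm z * norm (sgn z - sgn w)"
      using P_le by (simp add: mult_right_mono)
    also have "\<dots> = 2 * norm (norm z *\<^sub>R (sgn z - sgn w))" by simp
    also have "norm z *\<^sub>R (sgn z - sgn w) = (z - w) + (norm w - norm z) *\<^sub>R sgn w"
      using False by (cases "z = 0") (simp_all add: sgn_div_norm algebra_simps)
    also have "norm \<dots> \<le> norm (z - w) + \<bar>norm w - norm z\<bar>"
      using False by (intro norm_triangle_le add_mono) (simp_all add: norm_sgn)
    also have "\<dots> \<le> 2 * norm (z - w)"
      using norm_triangle_ineq3[of w z] by (simp add: norm_minus_commute)
    finally show ?thesis by simp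
  qed
  moreover have "norm ((P (norm z) - P (norm w)) *\<^sub>R sgn w) \<le> 2 * norm (z - w)"
  proof -
    have "norm ((P (norm z) - P (norm w)) *\<^sub>R sgn w) \<le> \<bar>P (norm z) - P (norm w)\<bar>"
      by (simp add: norm_sgn)
    also have "\<dots> \<le> 2 * \<bar>norm z - norm w\<bar>" by (rule P_diff)
    also have "\<dots> \<le> 2 * norm (z - w)" using norm_triangle_ineq3[of z w] by simp
    finally show ?thesis .
  qed
  ultimately have "norm (P (norm z) *\<^sub>R (sgn z - sgn w))
      + norm ((P (norm z) - P (norm w)) *\<^sub>R sgn w) \<le> 6 * norm (z - w)"
    by simp
  moreover have "radial_bump_grad z - radial_bump_grad w
      = P (norm z) *\<^sub>R (sgn z - sgn w) + (P (norm z) - P (norm w)) *\<^sub>R sgn w"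
    by (simp add: radial_bump_grad_def P_def algebra_simps)
  ultimately show ?case by (metis norm_triangle_le)
qed

lemma DERIV_radial_bump_line:
  "((\<lambda>t. radial_bump (z + t *\<^sub>R v)) has_real_derivative radial_bump_grad (z + t *\<^sub>R v) \<bullet> v) (at t)"
proof -
  have "((\<lambda>t. z + t *\<^sub>R v) has_derivative (\<lambda>s. s *\<^sub>R v)) (at t)"
    by (auto intro!: derivative_eq_intros)
  from has_derivative_compose[OF this has_derivative_radial_bump]
  show ?thesis by (simp add: has_field_derivative_def mult.commute[of _ "_ \<bullet> _"] fun_eq_iff)
qed

text \<open>Mean value theorem on both sides of \<open>z\<close>: the two intermediate parameters
  differ by less than 2, and the gradient has Lipschitz constant 6.\<close>

lemma radial_bump_second_diff:
  "\<bar>radial_bump (z + v) + radial_bump (z - v) - 2 * radial_bump z\<bar> \<le> 12 * (norm v)\<^sup>2"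
proof -
  define \<phi> where "\<phi> t = radial_bump (z + t *\<^sub>R v)" for t
  define \<phi>' where "\<phi>' t = radial_bump_grad (z + t *\<^sub>R v) \<bullet> v" for t
  have D: "(\<phi> has_real_derivative \<phi>' t) (at t)" for t
    unfolding \<phi>_def[abs_def] \<phi>'_def by (rule DERIV_radial_bump_line)
  obtain a where a: "0 < a" "a < 1" "\<phi> 1 - \<phi> 0 = (1 - 0) * \<phi>' a"
    using MVT2[of 0 1 \<phi> \<phi>'] D by auto
  obtain b where b: "- 1 < b" "b < 0" "\<phi> 0 - \<phi> (- 1) = (0 - (- 1)) * \<phi>' b"
    using MVT2[of "- 1" 0 \<phi> \<phi>'] D by auto
  have "\<bar>radial_bump (z + v) + radial_bump (z - v) - 2 * radial_bump z\<bar> = \<bar>\<phi>' a - \<phi>' b\<bar>"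
    using a b by (simp add: \<phi>_def)
  also have "\<dots> = \<bar>(radial_bump_grad (z + a *\<^sub>R v) - radial_bump_grad (z + b *\<^sub>R v)) \<bullet> v\<bar>"
    by (simp add: \<phi>'_def inner_diff_left)
  also have "\<dots> \<le> norm (radial_bump_grad (z + a *\<^sub>R v) - radial_bump_grad (z + b *\<^sub>R v)) * norm v"
    by (rule Cauchy_Schwarz_ineq2)
  also have "\<dots> \<le> (6 * norm ((z + a *\<^sub>R v) - (z + b *\<^sub>R v))) * norm v"
    by (intro mult_right_mono radial_bump_grad_lipschitz) simp
  also have "(z + a *\<^sub>R v) - (z + b *\<^sub>R v) = (a - b) *\<^sub>R v" by (simp add: algebra_simps)
  also have "6 * norm ((a - b) *\<^sub>R v) * norm v = 6 * (a - b) * (norm v)\<^sup>2"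
    using a b by (simp add: power2_eq_square)
  also have "\<dots> \<le> 12 * (norm v)\<^sup>2"
    using a b by (intro mult_right_mono) auto
  finally show ?thesis .
qed

section \<open>Detection of a jump of the second derivative\<close>

text \<open>
  Detects jumps of the second derivative: it is \<open>o(h\<^sup>2)\<close> for functions with a second-order
  expansion at \<open>0\<close>, and vanishes for even functions.
\<close>

definition third_diff :: "(real \<Rightarrow> real) \<Rightarrow> real \<Rightarrow> real" where
  "third_diff \<phi> h = \<phi> (2 * h) - 2 * \<phi> h + 2 * \<phi> (- h) - \<phi> (- 2 * h)"

lemma third_diff_tendsto_0:
  fixes \<phi> :: "real \<Rightarrow> real"
  assumes D: "\<And>t. (\<phi> has_real_derivative \<phi>' t) (at t)"
    and D2: "(\<phi>' has_real_derivative d) (at 0)"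
  shows "((\<lambda>h. third_diff \<phi> h / h\<^sup>2) \<longlongrightarrow> 0) (at_right 0)"
proof -
  \<comment> \<open>\<open>third_diff \<phi> h = \<omega> (2 * h) - 2 * \<omega> h\<close>, where
    the linear term cancels. By l'Hopital \<open>\<omega>\<close> is o(h^2), because the right and
    left difference quotients of \<open>\<phi>'\<close> at 0 have the same limit
    \<open>d\<close>.\<close>
  define \<omega> where "\<omega> h = \<phi> h - \<phi> (- h) - 2 * h * \<phi>' 0" for h
  have \<omega>: "((\<lambda>h. \<omega> h / h\<^sup>2) \<longlongrightarrow> 0) (at_right 0)"
  proof (rule lhopital_right_0)
    have "isCont \<phi> 0" using D by (rule DERIV_isCont)
    have D\<omega>: "(\<omega> has_real_derivative (\<phi>' t + \<phi>' (- t) - 2 * \<phi>' 0)) (at t)" for t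
      unfolding \<omega>_def[abs_def] by (auto intro!: derivative_eq_intros D DERIV_chain2[OF D])
    then show "\<forall>\<^sub>F t in at_right 0. (\<omega> has_real_derivative (\<phi>' t + \<phi>' (- t) - 2 * \<phi>' 0)) (at t)"
      by simp
    have "isCont \<omega> 0" using D\<omega> by (rule DERIV_isCont)
    then show "(\<omega> \<longlongrightarrow> 0) (at_right 0)"
      using filterlim_at_split[of \<omega> "nhds 0" 0] by (simp add: isCont_def \<omega>_def)
    show "((\<lambda>h. h\<^sup>2) \<longlongrightarrow> 0) (at_right (0 :: real))" by (auto intro!: tendsto_eq_intros)
    show "\<forall>\<^sub>F t in at_right 0. ((\<lambda>h. h\<^sup>2) has_real_derivative (2 * t)) (at t)"
      by (auto intro!: derivative_eq_intros always_eventually)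
    show "\<forall>\<^sub>F h in at_right 0. h\<^sup>2 \<noteq> (0 :: real)" "\<forall>\<^sub>F h in at_right 0. 2 * h \<noteq> (0 :: real)"
      by (auto simp: eventually_at_filter)
    have "((\<lambda>t. (\<phi>' t - \<phi>' 0) / t) \<longlongrightarrow> d) (at 0)"
      using D2 by (simp add: has_field_derivative_iff)
    then have *: "((\<lambda>t. (\<phi>' t - \<phi>' 0) / t) \<longlongrightarrow> d) (at_right 0)" "((\<lambda>t. (\<phi>' t - \<phi>' 0) / t) \<longlongrightarrow> d) (at_left 0)"
      by (simp_all add: filterlim_at_split)
    have "((\<lambda>t. (\<phi>' (- t) - \<phi>' 0) / (- t)) \<longlongrightarrow> d) (at_right 0)"
      using filterlim_at_left_to_right[THEN iffD1, OF *(2)] by simp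
    from tendsto_mult_left[OF tendsto_diff[OF *(1) this], of "1 / 2"]
    show "((\<lambda>t. (\<phi>' t + \<phi>' (- t) - 2 * \<phi>' 0) / (2 * t)) \<longlongrightarrow> 0) (at_right 0)"
      by (simp add: field_simps add_divide_distrib diff_divide_distrib)
  qed
  have "filterlim (\<lambda>h. 2 * h) (at_right 0) (at_right (0 :: real))"
    unfolding filterlim_at by (auto intro!: tendsto_eq_intros simp: eventually_at_filter)
  from filterlim_compose[OF \<omega> this]
  have "((\<lambda>h. 4 * (\<omega> (2 * h) / (2 * h)\<^sup>2) - 2 * (\<omega> h / h\<^sup>2)) \<longlongrightarrow> 4 * 0 - 2 * 0) (at_right 0)"
    by (intro tendsto_intros \<omega>)
  moreover have "4 * (\<omega> (2 * h) / (2 * h)\<^sup>2) - 2 * (\<omega> h / h\<^sup>2) = third_diff \<phi> h / h\<^sup>2" for h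
  proof -
    have "third_diff \<phi> h = \<omega> (2 * h) - 2 * \<omega> h" by (simp add: \<omega>_def third_diff_def)
    then show ?thesis by (simp add: power_mult_distrib diff_divide_distrib)
  qed
  ultimately show ?thesis by simp
qed

text \<open>The gradient formula is singular at the centre, where evenness of the bump is used
  instead; elsewhere in the ball the gradient is differentiable along the line, and outside it
  vanishes.\<close>

lemma third_diff_radial_bump_off_sphere:
  assumes "norm z \<noteq> pi / 2"
  shows "((\<lambda>h. third_diff (\<lambda>t. radial_bump (z + t *\<^sub>R v)) h / h\<^sup>2) \<longlongrightarrow> 0) (at_right 0)"
proof (cases "z = 0")
  case True
  then show ?thesis
    using radial_bump_uminus[of "_ *\<^sub>R v"] by (simp add: third_diff_def)
next
  case False
  let ?c = "\<lambda>t. z + t *\<^sub>R v"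
  have "\<exists>d. ((\<lambda>t. radial_bump_grad (?c t) \<bullet> v) has_real_derivative d) (at 0)"
  proof (cases "norm z < pi / 2")
    case True
    let ?q = "\<lambda>t. - sin (2 * norm (?c t)) * ((?c t \<bullet> v) / norm (?c t))"
    have c: "(?c has_derivative (\<lambda>s. s *\<^sub>R v)) (at 0)"
      by (auto intro!: derivative_eq_intros)
    have "(norm has_derivative (\<lambda>w. w \<bullet> sgn z)) (at (?c 0))"
      using has_derivative_norm[OF \<open>z \<noteq> 0\<close>] by simp
    from has_derivative_compose[OF c this]
    have N: "((\<lambda>t. norm (?c t)) has_real_derivative v \<bullet> sgn z) (at 0)"
      by (simp add: has_field_derivative_def mult_commute_abs)
    have M: "((\<lambda>t. ?c t \<bullet> v) has_real_derivative v \<bullet> v) (at 0)"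
      by (auto intro!: derivative_eq_intros simp: inner_add_left)
    have "norm (?c 0) \<noteq> 0" using \<open>z \<noteq> 0\<close> by simp
    from DERIV_mult[OF DERIV_minus[OF DERIV_chain2[OF DERIV_sin DERIV_cmult[OF N]]] DERIV_divide[OF M N this]]
    obtain d where d: "(?q has_real_derivative d) (at 0)" by blast
    have "((\<lambda>t. radial_bump_grad (?c t) \<bullet> v) has_real_derivative d) (at 0)"
    proof (rule has_field_derivative_transform_within_open[OF d])
      show "open {t. norm (?c t) < pi / 2}" by (intro open_Collect_less continuous_intros)
    next
      have "sgn w \<bullet> v = (w \<bullet> v) / norm w" for w
        by (simp add: sgn_div_norm divide_inverse_commute)
      then show "- sin (2 * norm (?c t)) * ((?c t \<bullet> v) / norm (?c t)) = radial_bump_grad (?c t) \<bullet> v"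
        if "t \<in> {t. norm (?c t) < pi / 2}" for t
        using that by (simp add: radial_bump_grad_def min_absorb1 less_imp_le)
    qed (use True in simp)
    then show ?thesis by blast
  next
    case False
    have "((\<lambda>t. radial_bump_grad (?c t) \<bullet> v) has_real_derivative 0) (at 0)"
    proof (rule has_field_derivative_transform_within_open[OF DERIV_const])
      show "open {t. pi / 2 < norm (?c t)}" by (intro open_Collect_less continuous_intros)
    qed (use False assms in \<open>auto simp: radial_bump_grad_def min_absorb2\<close>)
    then show ?thesis by blast
  qed
  then show ?thesis using third_diff_tendsto_0[OF DERIV_radial_bump_line] by blast
qed

text \<open>Along the outward normal the bump is the squared sine for negative \<open>t\<close> and
  0 afterwards. Only the values at \<open>- h\<close> and \<open>- 2 * h\<close> survive, which
  gives 2 - 4 = -2.\<close>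

lemma third_diff_radial_bump_on_sphere:
  fixes n :: "'a::real_inner"
  assumes "norm n = 1"
  shows "((\<lambda>h. third_diff (\<lambda>t. radial_bump ((pi / 2) *\<^sub>R n + t *\<^sub>R n)) h / h\<^sup>2) \<longlongrightarrow> - 2) (at_right 0)"
proof -
  have val: "radial_bump ((pi / 2) *\<^sub>R n + t *\<^sub>R n) = (if t < 0 then (sin t)\<^sup>2 else 0)"
    if "\<bar>t\<bar> < pi / 2" for t
  proof -
    have "norm ((pi / 2) *\<^sub>R n + t *\<^sub>R n) = pi / 2 + t"
      using that assms by (simp flip: scaleR_add_left)
    then show ?thesis
      using that by (auto simp: radial_bump_def trunc_cos_sq_inside trunc_cos_sq_outside cos_add)
  qed
  have "((\<lambda>h. (2 * (sin h)\<^sup>2 - (sin (2 * h))\<^sup>2) / h\<^sup>2) \<longlongrightarrow> - 2) (at_right (0 :: real))"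
    by real_asymp
  moreover have "\<forall>\<^sub>F h in at_right 0. third_diff (\<lambda>t. radial_bump ((pi / 2) *\<^sub>R n + t *\<^sub>R n)) h / h\<^sup>2
      = (2 * (sin h)\<^sup>2 - (sin (2 * h))\<^sup>2) / h\<^sup>2"
    using eventually_at_right_less[of "0::real"] eventually_at_right_real[OF half_gt_zero[OF pi_half_gt_zero]]
  proof eventually_elim
    case (elim h)
    then show ?case using val[of "- h"] val[of "- 2 * h"] val[of h] val[of "2 * h"]
      by (simp add: third_diff_def)
  qed
  ultimately show ?thesis by (simp only: tendsto_cong)
qed

lemma third_diff_reflect: "third_diff (\<lambda>t. \<phi> (- t)) h = - third_diff \<phi> h"
  by (simp add: third_diff_def)

text \<open>Here the line enters the ball; evenness of the bump reverses it, and the odd difference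
  changes sign.\<close>

lemma third_diff_radial_bump_on_sphere':
  fixes n :: "'a::real_inner"
  assumes "norm n = 1"
  shows "((\<lambda>h. third_diff (\<lambda>t. radial_bump (- (pi / 2) *\<^sub>R n + t *\<^sub>R n)) h / h\<^sup>2) \<longlongrightarrow> 2) (at_right 0)"
proof -
  have "radial_bump (- (pi / 2) *\<^sub>R n + t *\<^sub>R n) = radial_bump ((pi / 2) *\<^sub>R n + (- t) *\<^sub>R n)" for t
    using radial_bump_uminus[of "(pi / 2) *\<^sub>R n + (- t) *\<^sub>R n"] by (simp add: algebra_simps)
  then have "third_diff (\<lambda>t. radial_bump (- (pi / 2) *\<^sub>R n + t *\<^sub>R n)) h
      = - third_diff (\<lambda>t. radial_bump ((pi / 2) *\<^sub>R n + t *\<^sub>R n)) h" for h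
    by (simp only: third_diff_reflect[symmetric])
  then show ?thesis
    using tendsto_minus[OF third_diff_radial_bump_on_sphere[OF assms]] by simp
qed

section \<open>The kernel on the torus\<close>

definition torus_bump :: "real \<Rightarrow> real ^ 'n \<Rightarrow> real" where
  "torus_bump \<kappa> u = trunc_cos_sq (infdist u int_lattice / \<kappa>)"

lemma HK_kernel_eq_torus_bump:
  "HK_kernel \<kappa> (torus_proj u) (torus_proj v) = torus_bump \<kappa> (u - v)"
  by (simp add: HK_kernel_torus_proj torus_bump_def)

lemma int_lattice_norm_ge_1:
  fixes l :: "real ^ 'n::finite"
  assumes "l \<in> int_lattice" "l \<noteq> 0"
  shows "1 \<le> norm l"
proof -
  obtain i where "l $ i \<noteq> 0" using assms(2) by (auto simp: vec_eq_iff)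
  moreover have "l $ i \<in> \<int>" using assms(1) by (simp add: int_lattice_def)
  ultimately have "1 \<le> \<bar>l $ i\<bar>" by (rule Ints_nonzero_abs_ge1[rotated])
  also have "\<dots> \<le> norm l" by (rule component_le_norm_cart)
  finally show ?thesis .
qed

text \<open>Distinct lattice points are at least 1 apart. For \<kappa> * pi \<le> 1 this keeps a
  point from lying strictly within \<kappa> * pi / 2 of two of them.\<close>

lemma int_lattice_other_ge:
  fixes u :: "real ^ 'n::finite"
  assumes "l \<in> int_lattice" "l' \<in> int_lattice" "l \<noteq> l'"
  shows "1 \<le> norm (u - l) + norm (u - l')"
proof -
  have "1 \<le> norm (l' - l)"
    using assms by (intro int_lattice_norm_ge_1 int_lattice_diff) auto
  also have "l' - l = (u - l) - (u - l')" by simp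
  also have "norm \<dots> \<le> norm (u - l) + norm (u - l')" by (rule norm_triangle_ineq4)
  finally show ?thesis .
qed

lemma radial_bump_scaled: "0 < \<kappa> \<Longrightarrow> radial_bump (z /\<^sub>R \<kappa>) = trunc_cos_sq (norm z / \<kappa>)"
  by (simp add: radial_bump_def divide_inverse mult.commute)

lemma radial_bump_scaled_outside:
  "0 < \<kappa> \<Longrightarrow> \<kappa> * pi / 2 \<le> norm z \<Longrightarrow> radial_bump (z /\<^sub>R \<kappa>) = 0"
  by (subst radial_bump_scaled) (auto intro!: trunc_cos_sq_outside simp: field_simps)

lemma torus_bump_ge:
  assumes "0 < \<kappa>" "l \<in> int_lattice"
  shows "radial_bump ((u - l) /\<^sub>R \<kappa>) \<le> torus_bump \<kappa> u"
  unfolding radial_bump_scaled[OF assms(1)] torus_bump_def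
  using assms infdist_int_lattice_le[OF assms(2), of u]
  by (intro trunc_cos_sq_antimono) (auto simp: divide_right_mono infdist_nonneg)

lemma torus_bump_eq:
  assumes "0 < \<kappa>" "infdist u int_lattice = norm (u - l)"
  shows "torus_bump \<kappa> u = radial_bump ((u - l) /\<^sub>R \<kappa>)"
  using assms by (simp add: radial_bump_scaled torus_bump_def)

text \<open>
  The kernel is the maximum of the bumps around the lattice points, and a maximum inherits a
  uniform lower bound on second differences.
\<close>

lemma torus_bump_second_diff_ge:
  fixes u :: "real ^ 'n::finite"
  assumes "0 < \<kappa>"
  shows "- (12 / \<kappa>\<^sup>2 * (norm v)\<^sup>2) \<le> torus_bump \<kappa> (u + v) + torus_bump \<kappa> (u - v) - 2 * torus_bump \<kappa> u"
proof -
  obtain l where l: "l \<in> int_lattice" "infdist u int_lattice = norm (u - l)"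
    by (rule infdist_int_lattice_attained)
  let ?z = "(u - l) /\<^sub>R \<kappa>" and ?w = "v /\<^sub>R \<kappa>"
  have "12 * (norm ?w)\<^sup>2 = 12 / \<kappa>\<^sup>2 * (norm v)\<^sup>2"
    using assms by (simp add: power_mult_distrib power_inverse divide_inverse mult_ac)
  moreover have "radial_bump (?z + ?w) \<le> torus_bump \<kappa> (u + v)"
    using torus_bump_ge[OF assms l(1), of "u + v"] by (simp add: algebra_simps)
  moreover have "radial_bump (?z - ?w) \<le> torus_bump \<kappa> (u - v)"
    using torus_bump_ge[OF assms l(1), of "u - v"] by (simp add: algebra_simps)
  ultimately show ?thesis
    using radial_bump_second_diff[of ?z ?w] torus_bump_eq[OF assms l(2)] by linarith
qed

text \<open>For \<open>\<kappa> * pi \<le> 1\<close> the bumps around different lattice points have disjoint supports.\<close>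

lemma torus_bump_sum:
  fixes u :: "real ^ 'n::finite"
  assumes \<kappa>: "0 < \<kappa>" "\<kappa> * pi \<le> 1" and F: "finite F" "F \<subseteq> int_lattice" "l \<in> F"
    and l: "infdist u int_lattice = norm (u - l)"
  shows "torus_bump \<kappa> u = (\<Sum>l\<in>F. radial_bump ((u - l) /\<^sub>R \<kappa>))"
proof -
  have "radial_bump ((u - k) /\<^sub>R \<kappa>) = 0" if "k \<in> F - {l}" for k
  proof (rule radial_bump_scaled_outside[OF \<kappa>(1)])
    have "k \<in> int_lattice" "l \<in> int_lattice" using that F by auto
    then have "1 \<le> norm (u - l) + norm (u - k)" "norm (u - l) \<le> norm (u - k)"
      using that l infdist_int_lattice_le[of k u] int_lattice_other_ge[of l k u] by auto
    then show "\<kappa> * pi / 2 \<le> norm (u - k)" using \<kappa> by linarith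
  qed
  then show ?thesis
    using F torus_bump_eq[OF \<kappa>(1) l] by (simp add: sum.remove)
qed

section \<open>Third differences of the kernel on the torus\<close>

text \<open>A difference of two second differences, centred at \<open>z + h *\<^sub>R w\<close> and
  \<open>z - h *\<^sub>R w\<close>; each contributes 12.\<close>

lemma third_diff_radial_bump_bound:
  "\<bar>third_diff (\<lambda>t. radial_bump (z + t *\<^sub>R w)) h\<bar> \<le> 24 * (norm w)\<^sup>2 * h\<^sup>2"
proof -
  have "norm (h *\<^sub>R w) ^ 2 = (norm w)\<^sup>2 * h\<^sup>2"
    by (simp add: power_mult_distrib)
  moreover have "third_diff (\<lambda>t. radial_bump (z + t *\<^sub>R w)) h
    = (radial_bump ((z + h *\<^sub>R w) + h *\<^sub>R w) + radial_bump ((z + h *\<^sub>R w) - h *\<^sub>R w) - 2 * radial_bump (z + h *\<^sub>R w))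
    - (radial_bump ((z - h *\<^sub>R w) + h *\<^sub>R w) + radial_bump ((z - h *\<^sub>R w) - h *\<^sub>R w) - 2 * radial_bump (z - h *\<^sub>R w))"
  proof -
    define a where "a = h *\<^sub>R w"
    have "(2 * h) *\<^sub>R w = a + a" "(- 2 * h) *\<^sub>R w = - a - a" "(- h) *\<^sub>R w = - a"
      by (simp_all add: a_def flip: scaleR_add_left scaleR_diff_left scaleR_minus_left)
    then show ?thesis
      unfolding third_diff_def a_def[symmetric] by (simp only:) (simp add: algebra_simps)
  qed
  ultimately show ?thesis
    using radial_bump_second_diff[of "z + h *\<^sub>R w" "h *\<^sub>R w"]
      radial_bump_second_diff[of "z - h *\<^sub>R w" "h *\<^sub>R w"] by linarith
qed

lemma scaled_line: "(u + t *\<^sub>R n - l) /\<^sub>R \<kappa> = (u - l) /\<^sub>R \<kappa> + (t / \<kappa>) *\<^sub>R n"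
  for \<kappa> t :: real and u n l :: "'a::real_vector"
  by (simp add: scaleR_add_right scaleR_diff_right divide_inverse mult.commute)

lemma third_diff_sum: "third_diff (\<lambda>t. \<Sum>l\<in>F. \<phi> l t) h = (\<Sum>l\<in>F. third_diff (\<phi> l) h)"
  by (simp add: third_diff_def sum.distrib sum_subtractf sum_distrib_left)

text \<open>Supplies the dominating function. A maximum of bumps bounds second differences only from
  below, so the representation as a sum is used: four evaluation points need at most four lattice
  points, and 96 = 4 * 24.\<close>

lemma third_diff_torus_bump_bound:
  fixes u :: "real ^ 'n::finite"
  assumes \<kappa>: "0 < \<kappa>" "\<kappa> * pi \<le> 1" and n: "norm n = 1"
  shows "\<bar>third_diff (\<lambda>t. torus_bump \<kappa> (u + t *\<^sub>R n)) h\<bar> \<le> 96 / \<kappa>\<^sup>2 * h\<^sup>2"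
proof -
  define L where "L t = (SOME l. l \<in> int_lattice \<and>
    infdist (u + t *\<^sub>R n) int_lattice = norm (u + t *\<^sub>R n - l))" for t
  have "\<exists>l. l \<in> int_lattice \<and> infdist (u + t *\<^sub>R n) int_lattice = norm (u + t *\<^sub>R n - l)" for t
    by (rule infdist_int_lattice_attained[of "u + t *\<^sub>R n"]) blast
  from someI_ex[OF this]
  have L: "L t \<in> int_lattice" "infdist (u + t *\<^sub>R n) int_lattice = norm (u + t *\<^sub>R n - L t)" for t
    unfolding L_def by auto
  let ?T = "{2 * h, h, - h, - 2 * h}" and ?b = "\<lambda>l t. radial_bump ((u - l) /\<^sub>R \<kappa> + t *\<^sub>R (n /\<^sub>R \<kappa>))"
  have "torus_bump \<kappa> (u + t *\<^sub>R n) = (\<Sum>l\<in>L ` ?T. ?b l t)" if "t \<in> ?T" for t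
    using torus_bump_sum[OF \<kappa> _ _ _ L(2), of "L ` ?T" t] that L(1)
    by (auto simp: scaled_line divide_inverse)
  then have "third_diff (\<lambda>t. torus_bump \<kappa> (u + t *\<^sub>R n)) h = third_diff (\<lambda>t. \<Sum>l\<in>L ` ?T. ?b l t) h"
    by (simp only: third_diff_def insertI1 insertI2)
  also have "\<dots> = (\<Sum>l\<in>L ` ?T. third_diff (?b l) h)" by (rule third_diff_sum)
  also have "\<bar>\<dots>\<bar> \<le> (\<Sum>l\<in>L ` ?T. \<bar>third_diff (?b l) h\<bar>)" by (rule sum_abs)
  also have "\<dots> \<le> of_nat (card (L ` ?T)) * (24 / \<kappa>\<^sup>2 * h\<^sup>2)"
  proof (rule sum_bounded_above)
    have "(norm (n /\<^sub>R \<kappa>))\<^sup>2 = 1 / \<kappa>\<^sup>2"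
      using n by (simp add: power_inverse divide_inverse)
    then show "\<bar>third_diff (?b l) h\<bar> \<le> 24 / \<kappa>\<^sup>2 * h\<^sup>2" for l
      using third_diff_radial_bump_bound[of "(u - l) /\<^sub>R \<kappa>" "n /\<^sub>R \<kappa>" h] by simp
  qed
  also have "\<dots> \<le> of_nat 4 * (24 / \<kappa>\<^sup>2 * h\<^sup>2)"
  proof (intro mult_right_mono of_nat_mono)
    have "card (L ` ?T) \<le> card ?T" by (rule card_image_le) simp
    also have "\<dots> \<le> length [2 * h, h, - h, - 2 * h]"
      using card_length[of "[2 * h, h, - h, - 2 * h]"] by simp
    finally show "card (L ` ?T) \<le> 4" by simp
  qed simp
  finally show ?thesis by simp
qed

lemma torus_bump_local:
  fixes u :: "real ^ 'n::finite"
  assumes \<kappa>: "0 < \<kappa>" and n: "norm n = 1" and l: "l \<in> int_lattice"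
    and far: "\<And>k. k \<in> int_lattice \<Longrightarrow> k \<noteq> l \<Longrightarrow> \<kappa> * pi / 2 < norm (u - k)"
  obtains \<delta> where "0 < \<delta>"
    "\<And>t. \<bar>t\<bar> < \<delta> \<Longrightarrow> torus_bump \<kappa> (u + t *\<^sub>R n) = radial_bump ((u + t *\<^sub>R n - l) /\<^sub>R \<kappa>)"
proof -
  let ?S = "int_lattice - {l}"
  have "?S = int_lattice - ball l 1"
    using int_lattice_norm_ge_1[OF int_lattice_diff[OF l]] by (force simp: dist_norm)
  then have cl: "closed ?S" by (simp add: closed_Diff closed_int_lattice)
  \<comment> \<open>Nonemptiness of the remaining lattice, needed for its distance to be
    attained.\<close>
  have "l + axis undefined 1 \<in> ?S"
  proof -
    have "axis undefined 1 \<in> (int_lattice :: (real ^ 'n) set)" by (auto simp: int_lattice_def axis_def)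
    then show ?thesis using l int_lattice_add by auto
  qed
  then obtain k0 where k0: "k0 \<in> ?S" "infdist u ?S = dist u k0"
    using infdist_attains_inf[OF cl] by blast
  define \<delta> where "\<delta> = infdist u ?S - \<kappa> * pi / 2"
  show thesis
  proof
    show "0 < \<delta>" using k0 far[of k0] by (simp add: \<delta>_def dist_norm)
    fix t :: real assume t: "\<bar>t\<bar> < \<delta>"
    let ?w = "u + t *\<^sub>R n"
    obtain k where k: "k \<in> int_lattice" "infdist ?w int_lattice = norm (?w - k)"
      by (rule infdist_int_lattice_attained)
    show "torus_bump \<kappa> ?w = radial_bump ((?w - l) /\<^sub>R \<kappa>)"
    proof (cases "k = l")
      case True
      then show ?thesis using torus_bump_eq[OF \<kappa> k(2)] by simp
    next
      case False
      then have "infdist u ?S \<le> norm (u - k)"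
        using k infdist_le[of k ?S u] by (simp add: dist_norm)
      also have "\<dots> = norm ((?w - k) - t *\<^sub>R n)" by simp
      also have "\<dots> \<le> norm (?w - k) + \<bar>t\<bar>"
        using norm_triangle_ineq4[of "?w - k" "t *\<^sub>R n"] n by simp
      finally have "\<kappa> * pi / 2 \<le> norm (?w - k)" using t by (simp add: \<delta>_def)
      \<comment> \<open>Another lattice point is nearest but its bump vanishes at \<open>?w\<close>;
        so does the kernel, and with it the bump around \<open>l\<close>, which lies below the
        kernel.\<close>
      then have "torus_bump \<kappa> ?w = 0"
        using torus_bump_eq[OF \<kappa> k(2)] radial_bump_scaled_outside[OF \<kappa>] by simp
      then show ?thesis
        using torus_bump_ge[OF \<kappa> l, of ?w] radial_bump_nonneg[of "(?w - l) /\<^sub>R \<kappa>"] by linarith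
    qed
  qed
qed

lemma third_diff_torus_bump_tendsto:
  fixes u :: "real ^ 'n::finite"
  assumes \<kappa>: "0 < \<kappa>" and n: "norm n = 1" and l: "l \<in> int_lattice"
    and far: "\<And>k. k \<in> int_lattice \<Longrightarrow> k \<noteq> l \<Longrightarrow> \<kappa> * pi / 2 < norm (u - k)"
    and lim: "((\<lambda>h. third_diff (\<lambda>t. radial_bump ((u - l) /\<^sub>R \<kappa> + t *\<^sub>R n)) h / h\<^sup>2) \<longlongrightarrow> c) (at_right 0)"
  shows "((\<lambda>h. third_diff (\<lambda>t. torus_bump \<kappa> (u + t *\<^sub>R n)) h / h\<^sup>2) \<longlongrightarrow> c / \<kappa>\<^sup>2) (at_right 0)"
proof -
  let ?b = "\<lambda>t. radial_bump ((u - l) /\<^sub>R \<kappa> + t *\<^sub>R n)"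
  \<comment> \<open>Unit speed on the torus is speed \<open>1 / \<kappa>\<close> for the rescaled
    bump; this is the source of the factor \<open>1 / \<kappa>\<^sup>2\<close>.\<close>
  have "filterlim (\<lambda>h. h / \<kappa>) (at_right 0) (at_right (0 :: real))"
    unfolding filterlim_at using \<kappa> by (auto intro!: tendsto_eq_intros simp: eventually_at_filter)
  from tendsto_mult_left[OF filterlim_compose[OF lim this], of "1 / \<kappa>\<^sup>2"]
  have "((\<lambda>h. third_diff ?b (h / \<kappa>) / h\<^sup>2) \<longlongrightarrow> c / \<kappa>\<^sup>2) (at_right 0)"
    using \<kappa> by (simp add: power_divide)
  moreover obtain \<delta> where \<delta>: "0 < \<delta>"
    "\<And>t. \<bar>t\<bar> < \<delta> \<Longrightarrow> torus_bump \<kappa> (u + t *\<^sub>R n) = radial_bump ((u + t *\<^sub>R n - l) /\<^sub>R \<kappa>)"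
    using torus_bump_local[OF \<kappa> n l far] by blast
  have val: "torus_bump \<kappa> (u + t *\<^sub>R n) = ?b (t / \<kappa>)" if "\<bar>t\<bar> < \<delta>" for t
    using \<delta>(2)[OF that] by (simp only: scaled_line)
  have "\<forall>\<^sub>F h in at_right 0. third_diff (\<lambda>t. torus_bump \<kappa> (u + t *\<^sub>R n)) h / h\<^sup>2
      = third_diff ?b (h / \<kappa>) / h\<^sup>2"
    using eventually_at_right_real[OF half_gt_zero[OF \<delta>(1)]]
  proof eventually_elim
    case (elim h)
    then show ?case
      using val[of h] val[of "- h"] val[of "2 * h"] val[of "- 2 * h"]
      by (simp add: third_diff_def)
  qed
  ultimately show ?thesis by (simp only: tendsto_cong)
qed

lemma third_diff_torus_bump_off_sphere:
  fixes u :: "real ^ 'n::finite"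
  assumes \<kappa>: "0 < \<kappa>" "\<kappa> * pi \<le> 1" and n: "norm n = 1" and off: "infdist u int_lattice \<noteq> \<kappa> * pi / 2"
  shows "((\<lambda>h. third_diff (\<lambda>t. torus_bump \<kappa> (u + t *\<^sub>R n)) h / h\<^sup>2) \<longlongrightarrow> 0) (at_right 0)"
proof -
  obtain l where l: "l \<in> int_lattice" "infdist u int_lattice = norm (u - l)"
    by (rule infdist_int_lattice_attained)
  \<comment> \<open>With R = \<kappa> * pi / 2 \<le> 1 / 2: if \<open>l\<close> is nearer than R,
    every other lattice point is farther than 1 - R \<ge> R; if \<open>l\<close> is farther than R,
    so are all.\<close>
  have far: "\<kappa> * pi / 2 < norm (u - k)" if "k \<in> int_lattice" "k \<noteq> l" for k
    using int_lattice_other_ge[OF l(1) that(1) that(2)[symmetric], of u] infdist_int_lattice_le[OF that(1), of u]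
      that l off \<kappa>(2) by linarith
  have "norm ((u - l) /\<^sub>R \<kappa>) \<noteq> pi / 2"
  proof -
    have eq: "norm ((u - l) /\<^sub>R \<kappa>) = norm (u - l) / \<kappa>"
      using \<kappa>(1) by (simp add: divide_inverse mult.commute)
    show ?thesis unfolding eq using off \<kappa>(1) by (simp add: l(2) field_simps)
  qed
  from third_diff_torus_bump_tendsto[OF \<kappa>(1) n l(1) far third_diff_radial_bump_off_sphere[OF this]]
  show ?thesis by simp
qed

lemma third_diff_torus_bump_on_sphere:
  fixes u :: "real ^ 'n::finite"
  assumes \<kappa>: "0 < \<kappa>" and n: "norm n = 1" and l: "l \<in> int_lattice"
    and far: "\<And>k. k \<in> int_lattice \<Longrightarrow> k \<noteq> l \<Longrightarrow> \<kappa> * pi / 2 < norm (u - k)"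
  shows "u - l = (\<kappa> * pi / 2) *\<^sub>R n \<Longrightarrow>
      ((\<lambda>h. third_diff (\<lambda>t. torus_bump \<kappa> (u + t *\<^sub>R n)) h / h\<^sup>2) \<longlongrightarrow> - 2 / \<kappa>\<^sup>2) (at_right 0)"
    and "u - l = - (\<kappa> * pi / 2) *\<^sub>R n \<Longrightarrow>
      ((\<lambda>h. third_diff (\<lambda>t. torus_bump \<kappa> (u + t *\<^sub>R n)) h / h\<^sup>2) \<longlongrightarrow> 2 / \<kappa>\<^sup>2) (at_right 0)"
proof -
  note * = third_diff_torus_bump_tendsto[OF \<kappa> n l far]
  assume "u - l = (\<kappa> * pi / 2) *\<^sub>R n"
  then have "(u - l) /\<^sub>R \<kappa> = (pi / 2) *\<^sub>R n" using \<kappa> by simp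
  from *[unfolded this, OF _ _ third_diff_radial_bump_on_sphere[OF n]]
  show "((\<lambda>h. third_diff (\<lambda>t. torus_bump \<kappa> (u + t *\<^sub>R n)) h / h\<^sup>2) \<longlongrightarrow> - 2 / \<kappa>\<^sup>2) (at_right 0)"
    by simp
next
  note * = third_diff_torus_bump_tendsto[OF \<kappa> n l far]
  assume "u - l = - (\<kappa> * pi / 2) *\<^sub>R n"
  then have "(u - l) /\<^sub>R \<kappa> = - (pi / 2) *\<^sub>R n" using \<kappa> by simp
  from *[unfolded this, OF _ _ third_diff_radial_bump_on_sphere'[OF n]]
  show "((\<lambda>h. third_diff (\<lambda>t. torus_bump \<kappa> (u + t *\<^sub>R n)) h / h\<^sup>2) \<longlongrightarrow> 2 / \<kappa>\<^sup>2) (at_right 0)"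
    by simp
qed

text \<open>\<open>J y\<close> is the jump at \<open>p\<close> caused by unit mass at
  \<open>y\<close>. The third difference of a constant potential vanishes and commutes with the
  integral, and dominated convergence along a sequence of steps exchanges limit and integral.
  Requiring the limit only almost everywhere confines attention to a carrier of
  \<open>\<nu>\<close>.\<close>

lemma integral_third_diff_limit_eq_0:
  fixes \<nu> :: "'n::finite torus measure"
  assumes \<kappa>: "0 < \<kappa>" "\<kappa> * pi \<le> 1" and n: "norm n = 1" and \<nu>: "\<nu> \<in> radon_measures"
    and const: "\<And>x. HK_potential \<kappa> \<nu> x = c"
    and J [measurable]: "J \<in> borel_measurable borel"
    and lim: "AE y in \<nu>. \<forall>w. y = torus_proj w \<longrightarrow>
      ((\<lambda>h. third_diff (\<lambda>t. torus_bump \<kappa> (p - w + t *\<^sub>R n)) h / h\<^sup>2) \<longlongrightarrow> J y) (at_right 0)"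
  shows "(\<integral>y. J y \<partial>\<nu>) = (0 :: real)"
proof -
  note \<nu>D = radon_measuresD[OF \<nu>]
  interpret finite_measure \<nu> by (rule \<nu>D)
  have [measurable_cong]: "sets \<nu> = sets borel" by (rule \<nu>D)
  let ?k = "\<lambda>y t. HK_kernel \<kappa> (torus_proj (p + t *\<^sub>R n)) y"
  have k: "?k (torus_proj w) = (\<lambda>t. torus_bump \<kappa> (p - w + t *\<^sub>R n))" for w
    by (simp add: HK_kernel_eq_torus_bump fun_eq_iff algebra_simps)
  define h where "h m = 1 / real (Suc m)" for m
  have h_pos: "0 < h m" for m by (simp add: h_def)
  have "filterlim h (at_right 0) sequentially"
    unfolding filterlim_at h_def
    using LIMSEQ_inverse_real_of_nat by (simp add: inverse_eq_divide)
  note h_lim = filterlim_compose[OF _ this]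
  have "(\<lambda>m. \<integral>y. third_diff (?k y) (h m) / (h m)\<^sup>2 \<partial>\<nu>) \<longlonglongrightarrow> (\<integral>y. J y \<partial>\<nu>)"
  proof (rule integral_dominated_convergence)
    show "(\<lambda>y. third_diff (?k y) (h m) / (h m)\<^sup>2) \<in> borel_measurable \<nu>" for m
      unfolding third_diff_def by measurable
    show "integrable \<nu> (\<lambda>_. 96 / \<kappa>\<^sup>2)" by simp
    show "AE y in \<nu>. (\<lambda>m. third_diff (?k y) (h m) / (h m)\<^sup>2) \<longlonglongrightarrow> J y"
      using lim
    proof eventually_elim
      case (elim y)
      obtain w where w: "y = torus_proj w" by (rule torus_proj_surj)
      show ?case using h_lim[OF elim[rule_format, OF w]] by (simp add: w k)
    qed
    show "AE y in \<nu>. norm (third_diff (?k y) (h m) / (h m)\<^sup>2) \<le> 96 / \<kappa>\<^sup>2" for m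
    proof (rule AE_I2)
      fix y :: "'n torus"
      obtain w where w: "y = torus_proj w" by (rule torus_proj_surj)
      show "norm (third_diff (?k y) (h m) / (h m)\<^sup>2) \<le> 96 / \<kappa>\<^sup>2"
        using third_diff_torus_bump_bound[OF \<kappa> n, of "p - w" "h m"] h_pos[of m]
        unfolding w k by (simp add: divide_le_eq)
    qed
  qed measurable
  moreover have "(\<integral>y. third_diff (?k y) (h m) / (h m)\<^sup>2 \<partial>\<nu>) = 0" for m
  proof -
    have "(\<integral>y. third_diff (?k y) (h m) \<partial>\<nu>)
        = third_diff (\<lambda>t. HK_potential \<kappa> \<nu> (torus_proj (p + t *\<^sub>R n))) (h m)"
      unfolding third_diff_def HK_potential_def using integrable_HK_kernel[OF \<nu>] by simp
    then show ?thesis by (simp add: const third_diff_def)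
  qed
  ultimately have "(\<lambda>_. 0) \<longlonglongrightarrow> (\<integral>y. J y \<partial>\<nu>)" by (simp only:)
  then show ?thesis by (simp add: LIMSEQ_const_iff)
qed

section \<open>Discrete barycenters\<close>

lemma discrete_measure_AE_countable:
  assumes "discrete_measure \<nu>"
  obtains A where "countable A" "AE y in \<nu>. y \<in> A"
proof -
  obtain w :: "nat \<Rightarrow> ennreal" and x where s: "sets \<nu> = sets borel"
    and wx: "\<And>B. B \<in> sets borel \<Longrightarrow> emeasure \<nu> B = (\<Sum>i. w i * emeasure (return borel (x i)) B)"
    using assms by (auto simp: discrete_measure_def)
  have c: "countable (range x)" by simp
  have m: "range x \<in> sets borel" by (rule sets.countable[OF _ c]) simp
  then have "emeasure \<nu> (- range x) = 0"
    by (subst wx) (auto simp: emeasure_return)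
  then have "- range x \<in> null_sets \<nu>" using m s by (auto simp: null_sets_def)
  from AE_not_in[OF this] show thesis using that[OF c] by simp
qed

lemma radon_measure_atom:
  assumes \<nu>: "\<nu> \<in> radon_measures" and A: "countable A" "AE y in \<nu>. y \<in> A"
    and pos: "0 < measure \<nu> UNIV"
  obtains x where "0 < measure \<nu> {x}"
proof -
  note \<nu>D = radon_measuresD[OF \<nu>]
  interpret finite_measure \<nu> by (rule \<nu>D)
  have "\<exists>x. 0 < measure \<nu> {x}"
  proof (rule ccontr)
    assume "\<not> (\<exists>x. 0 < measure \<nu> {x})"
    then have zero: "emeasure \<nu> {x} = 0" for x
      by (simp add: emeasure_eq_measure less_le)
    have "A \<in> sets \<nu>" unfolding \<nu>D by (rule sets.countable[OF _ A(1)]) simp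
    have "emeasure \<nu> A = (\<integral>\<^sup>+x. emeasure \<nu> {x} \<partial>count_space A)"
      using A(1) \<nu>D(1) by (intro emeasure_countable_singleton) auto
    then have "A \<in> null_sets \<nu>" using \<open>A \<in> sets \<nu>\<close> by (auto simp: zero)
    from AE_not_in[OF this] A(2) have "AE y in \<nu>. False" by eventually_elim blast
    then have "emeasure \<nu> UNIV = 0" by (simp add: AE_iff_null \<nu>D null_sets_def)
    then show False using pos \<nu>D by simp
  qed
  then show thesis using that by blast
qed

lemma abs_diff_int_ge:
  fixes t :: real
  assumes "\<bar>t\<bar> \<le> 1 / 2" "k \<in> \<int>"
  shows "\<bar>t\<bar> \<le> \<bar>t - k\<bar>"
proof (cases "k = 0")
  case False
  then have "1 \<le> \<bar>k\<bar>" using assms by (intro Ints_nonzero_abs_ge1)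
  then show ?thesis using assms by linarith
qed simp

lemma axis_in_int_lattice: "of_int k *\<^sub>R axis i 1 \<in> int_lattice"
  by (auto simp: int_lattice_def axis_def)

lemma infdist_int_lattice_axis:
  fixes i :: "'n::finite"
  assumes "\<bar>t\<bar> \<le> 1 / 2"
  shows "infdist (t *\<^sub>R axis i 1) int_lattice = \<bar>t\<bar>"
proof -
  let ?u = "t *\<^sub>R axis i 1 :: real ^ 'n"
  obtain l where l: "l \<in> int_lattice" "infdist ?u int_lattice = norm (?u - l)"
    by (rule infdist_int_lattice_attained)
  have "\<bar>t\<bar> \<le> \<bar>t - l $ i\<bar>"
    using l(1) assms by (intro abs_diff_int_ge) (auto simp: int_lattice_def)
  also have "\<dots> \<le> norm (?u - l)"
    using component_le_norm_cart[of "?u - l" i] by simp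
  finally have "\<bar>t\<bar> \<le> infdist ?u int_lattice" by (simp add: l)
  moreover have "infdist ?u int_lattice \<le> \<bar>t\<bar>"
    using infdist_int_lattice_le[OF int_lattice_zero, of ?u] by simp
  ultimately show ?thesis by simp
qed

lemma torus_bump_axis:
  "\<bar>t\<bar> \<le> 1 / 2 \<Longrightarrow> torus_bump \<kappa> (t *\<^sub>R axis i 1) = trunc_cos_sq (\<bar>t\<bar> / \<kappa>)"
  by (simp add: torus_bump_def infdist_int_lattice_axis)

lemma torus_bump_add_lattice: "l \<in> int_lattice \<Longrightarrow> torus_bump \<kappa> (u + l) = torus_bump \<kappa> u"
  by (simp add: torus_bump_def infdist_int_lattice_translate)

section \<open>Nonexistence for \<kappa> * pi > 1\<close>

text \<open>
  For \<open>\<kappa> * pi > 1\<close> the kernel around an atom has a convex kink at the antipodal point, where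
  its slope jumps by \<open>2 * sin (1 / \<kappa>) / \<kappa>\<close>; no other mass can produce a compensating concave kink.
\<close>

lemma const_potential_no_atom_if_kink:
  fixes \<nu> :: "'n::finite torus measure"
  assumes \<kappa>: "0 < \<kappa>" "1 < \<kappa> * pi" and \<nu>: "\<nu> \<in> radon_measures"
    and const: "\<And>x. HK_potential \<kappa> \<nu> x = c"
  shows "measure \<nu> {x} = 0"
proof -
  note \<nu>D = radon_measuresD[OF \<nu>]
  interpret finite_measure \<nu> by (rule \<nu>D)
  have [measurable_cong]: "sets \<nu> = sets borel" by (rule \<nu>D)
  obtain u where u: "x = torus_proj u" by (rule torus_proj_surj)
  define e :: "real ^ 'n" where "e = axis undefined 1"
  \<comment> \<open>The antipode of the atom along one axis; \<open>G h\<close> is the gain of the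
    kernel when the distance shrinks from \<open>1 / 2\<close> to \<open>1 / 2 - h\<close>.\<close>
  define p where "p = u + (1 / 2) *\<^sub>R e"
  define G where "G h = (cos ((1 / 2 - h) / \<kappa>))\<^sup>2 - (cos ((1 / 2) / \<kappa>))\<^sup>2" for h
  let ?m = "measure \<nu> UNIV" and ?a = "measure \<nu> {x}"
  have inside: "r / \<kappa> \<le> pi / 2" if "r \<le> 1 / 2" for r
    using that \<kappa> by (simp add: field_simps)
  have ineq: "2 * ?a * (G h / h) \<le> 12 / \<kappa>\<^sup>2 * ?m * h" if h: "0 < h" "h < 1 / 2" for h
  proof -
    let ?q = "\<lambda>y. HK_kernel \<kappa> (torus_proj (p + h *\<^sub>R e)) y + HK_kernel \<kappa> (torus_proj (p - h *\<^sub>R e)) y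
      - 2 * HK_kernel \<kappa> (torus_proj p) y"
    have lower: "- (12 / \<kappa>\<^sup>2 * h\<^sup>2) \<le> ?q y" for y
    proof -
      obtain w where w: "y = torus_proj w" by (rule torus_proj_surj)
      show ?thesis
        using torus_bump_second_diff_ge[OF \<kappa>(1), of "h *\<^sub>R e" "p - w"] h
        by (simp add: w HK_kernel_eq_torus_bump e_def algebra_simps)
    qed
    have atom: "?q x = 2 * G h"
    proof -
      \<comment> \<open>Modulo the lattice, steps in both directions from \<open>p\<close> arrive at
        distance \<open>1 / 2 - h\<close> from the atom, so both produce the gain
        \<open>G h\<close>.\<close>
      have 1: "p + h *\<^sub>R e - u = (h - 1 / 2) *\<^sub>R e + of_int 1 *\<^sub>R e" "p - h *\<^sub>R e - u = (1 / 2 - h) *\<^sub>R e"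
        "p - u = (1 / 2) *\<^sub>R e"
        by (simp_all add: p_def vec_eq_iff field_simps)
      have "torus_bump \<kappa> ((h - 1 / 2) *\<^sub>R e + of_int 1 *\<^sub>R e) = torus_bump \<kappa> ((h - 1 / 2) *\<^sub>R e)"
        unfolding e_def by (rule torus_bump_add_lattice[OF axis_in_int_lattice])
      then show ?thesis
        unfolding u HK_kernel_eq_torus_bump 1
        using h \<kappa> inside[of "1 / 2 - h"] inside[of "1 / 2"]
        by (simp add: e_def torus_bump_axis trunc_cos_sq_inside G_def)
    qed
    have int: "integrable \<nu> ?q" using integrable_HK_kernel[OF \<nu>] by simp
    have "(\<integral>y. ?q y \<partial>\<nu>) = 0"
      using integrable_HK_kernel[OF \<nu>] const by (simp flip: HK_potential_def)
    \<comment> \<open>Away from the atom only the bound of order h^2 is available; the exact value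
      at the atom is of order h and dominates it for small h.\<close>
    moreover have "(\<integral>y. 2 * G h * indicator {x} y - 12 / \<kappa>\<^sup>2 * h\<^sup>2 \<partial>\<nu>) \<le> (\<integral>y. ?q y \<partial>\<nu>)"
    proof (rule integral_mono)
      show "2 * G h * indicator {x} y - 12 / \<kappa>\<^sup>2 * h\<^sup>2 \<le> ?q y" for y
        using lower[of y] atom by (cases "y = x") auto
      show "integrable \<nu> (\<lambda>y. 2 * G h * indicator {x} y - 12 / \<kappa>\<^sup>2 * h\<^sup>2)"
        by (intro Bochner_Integration.integrable_diff integrable_mult_right integrable_real_indicator)
           (simp_all add: \<nu>D less_top[symmetric])
    qed (rule int)
    moreover have "(\<integral>y. 2 * G h * indicator {x} y - 12 / \<kappa>\<^sup>2 * h\<^sup>2 \<partial>\<nu>) = 2 * G h * ?a - 12 / \<kappa>\<^sup>2 * h\<^sup>2 * ?m"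
      by (subst Bochner_Integration.integral_diff)
         (auto simp: \<nu>D intro!: integrable_mult_right integrable_real_indicator simp: less_top[symmetric])
    ultimately have "2 * G h * ?a \<le> 12 / \<kappa>\<^sup>2 * h\<^sup>2 * ?m" by simp
    then have "2 * G h * ?a / h \<le> 12 / \<kappa>\<^sup>2 * h\<^sup>2 * ?m / h"
      using h by (intro divide_right_mono) auto
    then show ?thesis using h by (simp add: power2_eq_square mult_ac)
  qed
  have "(G has_real_derivative sin (1 / \<kappa>) / \<kappa>) (at 0)"
    unfolding G_def[abs_def] using \<kappa> sin_double[of "1 / (2 * \<kappa>)"]
    by (auto intro!: derivative_eq_intros simp: field_simps)
  then have "((\<lambda>h. G h / h) \<longlongrightarrow> sin (1 / \<kappa>) / \<kappa>) (at_right 0)"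
    by (simp add: has_field_derivative_iff filterlim_at_split G_def)
  from tendsto_mult_left[OF this, of "2 * ?a"]
  have "2 * ?a * (sin (1 / \<kappa>) / \<kappa>) \<le> 12 / \<kappa>\<^sup>2 * ?m * 0"
  proof (rule tendsto_le[OF trivial_limit_at_right_real, rotated])
    show "((\<lambda>h. 12 / \<kappa>\<^sup>2 * ?m * h) \<longlongrightarrow> 12 / \<kappa>\<^sup>2 * ?m * 0) (at_right 0)"
      by (intro tendsto_intros)
    show "\<forall>\<^sub>F h in at_right 0. 2 * ?a * (G h / h) \<le> 12 / \<kappa>\<^sup>2 * ?m * h"
    proof (rule eventually_mono[OF eventually_at_right_real[of 0 "1 / 2"]])
      show "2 * ?a * (G h / h) \<le> 12 / \<kappa>\<^sup>2 * ?m * h" if "h \<in> {0<..<1 / 2}" for h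
        using that by (intro ineq) auto
    qed simp
  qed
  \<comment> \<open>\<open>1 < \<kappa> * pi\<close> places \<open>1 / \<kappa>\<close> strictly
    between 0 and \<open>pi\<close>.\<close>
  moreover have "0 < sin (1 / \<kappa>) / \<kappa>"
    using \<kappa> by (intro divide_pos_pos sin_gt_zero) (auto simp: field_simps)
  moreover have "?a \<le> 0" if "2 * ?a * S \<le> 0" "0 < S" for S
    using that by (simp add: mult_le_0_iff)
  ultimately have "?a \<le> 0" by (metis mult_zero_right)
  then show ?thesis by (simp add: measure_le_0_iff)
qed

section \<open>Nonexistence in dimension at least two\<close>

text \<open>On the circle spanned by \<open>e1\<close> and \<open>e2\<close>, the condition
  \<open>norm (R *\<^sub>R n - a) = R\<close> reads
  \<open>2 * R * (n \<bullet> a) = a \<bullet> a\<close>; each nonzero \<open>a\<close> therefore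
  rules out finitely many parameters, and countably many \<open>a\<close> cannot exhaust the
  reals.\<close>

lemma sphere_avoids_countable:
  fixes A :: "'a::real_inner set" and e1 e2 :: 'a
  assumes "countable A" and e: "norm e1 = 1" "norm e2 = 1" "e1 \<bullet> e2 = 0" and R: "0 < R"
  obtains n where "norm n = 1" "\<And>a. a \<in> A \<Longrightarrow> a \<noteq> 0 \<Longrightarrow> norm (R *\<^sub>R n - a) \<noteq> R"
proof -
  \<comment> \<open>Rational parametrization of the unit circle, so that each excluded point gives a quadratic equation.\<close>
  define n where "n s = ((1 - s\<^sup>2) / (1 + s\<^sup>2)) *\<^sub>R e1 + (2 * s / (1 + s\<^sup>2)) *\<^sub>R e2" for s :: real
  have pos: "0 < 1 + s\<^sup>2" for s :: real by (simp add: add_pos_nonneg)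
  have ee: "e1 \<bullet> e1 = 1" "e2 \<bullet> e2 = 1" "e2 \<bullet> e1 = 0"
    using e by (simp_all add: norm_eq_1 inner_commute)
  have n1: "n s \<bullet> n s = 1" for s
  proof -
    have "n s \<bullet> n s = ((1 - s\<^sup>2) / (1 + s\<^sup>2))\<^sup>2 + (2 * s / (1 + s\<^sup>2))\<^sup>2"
      by (simp add: n_def inner_add_left inner_add_right ee e power2_eq_square)
    also have "\<dots> = ((1 - s\<^sup>2)\<^sup>2 + (2 * s)\<^sup>2) / (1 + s\<^sup>2)\<^sup>2"
      by (simp add: power_divide add_divide_distrib)
    also have "(1 - s\<^sup>2)\<^sup>2 + (2 * s)\<^sup>2 = (1 + s\<^sup>2)\<^sup>2"
      by (simp add: power2_eq_square algebra_simps)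
    finally show ?thesis using pos[of s] by simp
  qed
  define bad where "bad a = {s. norm (R *\<^sub>R n s - a) = R}" for a :: 'a
  have "finite (bad a)" if "a \<noteq> 0" for a
  proof -
    define c where "c = (norm a)\<^sup>2"
    let ?p = "[: c - 2 * R * (e1 \<bullet> a), - 4 * R * (e2 \<bullet> a), c + 2 * R * (e1 \<bullet> a) :]"
    have "c \<noteq> 0" using that by (simp add: c_def)
    \<comment> \<open>The constant and the leading coefficient add up to \<open>2 * c\<close>, so
      they cannot both vanish.\<close>
    then have "?p \<noteq> 0" by auto
    moreover have "bad a \<subseteq> {s. poly ?p s = 0}"
    proof
      fix s assume "s \<in> bad a"
      then have "(norm (R *\<^sub>R n s - a))\<^sup>2 = R\<^sup>2" by (simp add: bad_def)
      then have "R * (R * (n s \<bullet> n s)) - 2 * R * (n s \<bullet> a) + c = R\<^sup>2"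
        by (simp add: power2_norm_eq_inner c_def inner_diff_left inner_diff_right inner_commute algebra_simps)
      then have "c = 2 * R * (n s \<bullet> a)" by (simp add: n1 power2_eq_square)
      also have "n s \<bullet> a = ((1 - s\<^sup>2) * (e1 \<bullet> a) + 2 * s * (e2 \<bullet> a)) / (1 + s\<^sup>2)"
        by (simp add: n_def inner_add_left add_divide_distrib)
      finally have "c * (1 + s\<^sup>2) = 2 * R * ((1 - s\<^sup>2) * (e1 \<bullet> a) + 2 * s * (e2 \<bullet> a))"
        using pos[of s] by (simp add: field_simps)
      then show "s \<in> {s. poly ?p s = 0}" by (simp add: power2_eq_square algebra_simps)
    qed
    ultimately show ?thesis using poly_roots_finite finite_subset by blast
  qed
  then have "countable (\<Union>a\<in>A - {0}. bad a)"
    using assms(1) by (intro countable_UN) (auto intro: countable_finite)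
  then obtain s where s: "s \<notin> (\<Union>a\<in>A - {0}. bad a)"
    using uncountable_UNIV_real by (metis UNIV_eq_I)
  show thesis
    by (rule that[of "n s"]) (use s n1[of s] in \<open>auto simp: bad_def norm_eq_1\<close>)
qed

lemma countable_torus_proj_vimage:
  fixes A :: "'n::finite torus set"
  assumes "countable A"
  shows "countable {w. torus_proj w \<in> A}"
proof -
  obtain L :: "'n torus \<Rightarrow> real ^ 'n" where L: "\<And>y. y = torus_proj (L y)"
    using torus_proj_surj by metis
  have "{w. torus_proj w \<in> A} \<subseteq> (\<Union>y\<in>A. (\<lambda>l. L y + l) ` int_lattice)"
  proof
    fix w assume "w \<in> {w. torus_proj w \<in> A}"
    moreover from L[of "torus_proj w"] have "w - L (torus_proj w) \<in> int_lattice"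
      by (simp only: torus_proj_eq_iff[symmetric])
    ultimately show "w \<in> (\<Union>y\<in>A. (\<lambda>l. L y + l) ` int_lattice)"
      by (auto intro!: bexI[of _ "torus_proj w"] image_eqI[of _ _ "w - L (torus_proj w)"])
  qed
  then show ?thesis
    by (rule countable_subset) (intro countable_UN countable_image assms countable_int_lattice)
qed

text \<open>At the chosen \<open>p\<close> the jump function is supported on \<open>x\<close> alone,
  so its vanishing integral is a nonzero multiple of the mass of \<open>x\<close>. Avoiding all
  lifts of \<open>A\<close> also controls the other lifts of \<open>x\<close>.\<close>

lemma discrete_const_potential_no_atom_dim_ge_2:
  fixes \<nu> :: "'n::finite torus measure"
  assumes \<kappa>: "0 < \<kappa>" "\<kappa> * pi \<le> 1" and dim: "1 < CARD('n)" and \<nu>: "\<nu> \<in> radon_measures"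
    and const: "\<And>x. HK_potential \<kappa> \<nu> x = c"
    and A: "countable A" "AE y in \<nu>. y \<in> A"
  shows "measure \<nu> {x} = 0"
proof -
  note \<nu>D = radon_measuresD[OF \<nu>]
  interpret finite_measure \<nu> by (rule \<nu>D)
  define R where "R = \<kappa> * pi / 2"
  have R: "0 < R" using \<kappa> by (simp add: R_def)
  obtain i j :: 'n where ij: "i \<noteq> j"
    using dim card_le_Suc0_iff_eq[of "UNIV :: 'n set"] by auto
  obtain u where u: "x = torus_proj u" by (rule torus_proj_surj)
  have "countable ((\<lambda>w. w - u) ` {w. torus_proj w \<in> A})"
    by (intro countable_image countable_torus_proj_vimage A)
  then obtain n :: "real ^ 'n" where n: "norm n = 1"
    and avoid: "\<And>a. a \<in> (\<lambda>w. w - u) ` {w. torus_proj w \<in> A} \<Longrightarrow> a \<noteq> 0 \<Longrightarrow> norm (R *\<^sub>R n - a) \<noteq> R"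
    by (rule sphere_avoids_countable[of _ "axis i 1" "axis j 1" R])
       (use ij R in \<open>auto simp: inner_axis_axis norm_axis_1\<close>)
  define p where "p = u + R *\<^sub>R n"
  have off: "norm (p - w) \<noteq> R" if "torus_proj w \<in> A" "w \<noteq> u" for w
    using avoid[of "w - u"] that by (auto simp: p_def algebra_simps)
  have "(\<integral>y. - 2 / \<kappa>\<^sup>2 * indicator {x} y \<partial>\<nu>) = 0"
  proof (rule integral_third_diff_limit_eq_0[OF \<kappa> n \<nu> const, of _ p])
    show "AE y in \<nu>. \<forall>w. y = torus_proj w \<longrightarrow>
      ((\<lambda>h. third_diff (\<lambda>t. torus_bump \<kappa> (p - w + t *\<^sub>R n)) h / h\<^sup>2)
        \<longlongrightarrow> - 2 / \<kappa>\<^sup>2 * indicator {x} y) (at_right 0)"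
      using A(2)
    proof (eventually_elim, intro allI impI)
      fix y w assume y: "y \<in> A" "y = torus_proj w"
      have lift: "norm (p - w - k) \<noteq> R" if "k \<in> int_lattice" "w + k \<noteq> u" for k
      proof -
        have "torus_proj (w + k) \<in> A" using y torus_proj_add_lattice[OF that(1), of w] by simp
        from off[OF this that(2)] show ?thesis by (simp add: diff_diff_eq)
      qed
      show "((\<lambda>h. third_diff (\<lambda>t. torus_bump \<kappa> (p - w + t *\<^sub>R n)) h / h\<^sup>2)
        \<longlongrightarrow> - 2 / \<kappa>\<^sup>2 * indicator {x} y) (at_right 0)"
      proof (cases "y = x")
        case True
        then have l: "u - w \<in> int_lattice" using y u torus_proj_eq_iff by metis
        have eq: "p - w - (u - w) = R *\<^sub>R n" by (simp add: p_def)
        \<comment> \<open>The lattice gives only a weak inequality when \<kappa> * pi = 1; equality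
          is excluded by the choice of \<open>n\<close>.\<close>
        have "\<kappa> * pi / 2 < norm (p - w - k)" if k: "k \<in> int_lattice" "k \<noteq> u - w" for k
        proof -
          have "1 \<le> R + norm (p - w - k)"
            using int_lattice_other_ge[OF l k(1), of "p - w"] k(2) n R by (simp add: eq)
          then have "R \<le> norm (p - w - k)" using \<kappa>(2) by (simp add: R_def)
          moreover have "w + k \<noteq> u" using k(2) by auto
          ultimately show ?thesis using lift[OF k(1)] by (simp add: R_def)
        qed
        from third_diff_torus_bump_on_sphere(1)[OF \<kappa>(1) n l this] eq True
        show ?thesis by (simp add: R_def)
      next
        case False
        have "infdist (p - w) int_lattice \<noteq> R"
        proof
          assume "infdist (p - w) int_lattice = R"
          moreover obtain k where k: "k \<in> int_lattice" "infdist (p - w) int_lattice = norm (p - w - k)"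
            by (rule infdist_int_lattice_attained)
          ultimately have "w + k = u" using lift by metis
          then show False using False y u k torus_proj_add_lattice by metis
        qed
        from third_diff_torus_bump_off_sphere[OF \<kappa> n this[unfolded R_def]] False
        show ?thesis by simp
      qed
    qed
  qed measurable
  then show ?thesis using \<kappa> \<nu>D by simp
qed

section \<open>Dimension one: nonexistence for irrational \<kappa> * pi\<close>

text \<open>Seen from the midpoint \<open>p\<close>, the two points are the only ones at distance
  \<kappa> * pi / 2. Moving along the axis leaves the ball around one and enters the ball around the
  other, so the jumps have opposite signs and cancel only for equal masses.\<close>

lemma const_potential_atom_shift:
  fixes \<nu> :: "'n::finite torus measure"
  assumes \<kappa>: "0 < \<kappa>" "\<kappa> * pi < 1" and dim: "\<And>j. j = (i :: 'n)" and \<nu>: "\<nu> \<in> radon_measures"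
    and const: "\<And>x. HK_potential \<kappa> \<nu> x = c"
  shows "measure \<nu> {torus_proj (u + (\<kappa> * pi) *\<^sub>R axis i 1)} = measure \<nu> {torus_proj u}"
proof -
  note \<nu>D = radon_measuresD[OF \<nu>]
  interpret finite_measure \<nu> by (rule \<nu>D)
  have [measurable_cong]: "sets \<nu> = sets borel" by (rule \<nu>D)
  define R where "R = \<kappa> * pi / 2"
  have R: "0 < R" "R < 1 / 2" using \<kappa> by (auto simp: R_def)
  define n :: "real ^ 'n" where "n = axis i 1"
  have n: "norm n = 1" by (simp add: n_def)
  define p where "p = u + R *\<^sub>R n"
  define x where "x = torus_proj (p - R *\<^sub>R n)"
  define y where "y = torus_proj (p + R *\<^sub>R n)"
  have one_dim: "v = (v $ i) *\<^sub>R n" for v :: "real ^ 'n"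
    unfolding vec_eq_iff n_def by (metis dim axis_nth mult.right_neutral real_scaleR_def vector_scaleR_component)
  \<comment> \<open>The lifts differ by less than 1; at \<kappa> * pi = 1 the two points would
    coincide.\<close>
  have "x \<noteq> y"
  proof
    assume "x = y"
    then have "(p + R *\<^sub>R n) - (p - R *\<^sub>R n) \<in> int_lattice"
      unfolding x_def y_def by (metis torus_proj_eq_iff)
    moreover have "(p + R *\<^sub>R n) - (p - R *\<^sub>R n) = (2 * R) *\<^sub>R n" by (simp add: scaleR_2 flip: scaleR_scaleR)
    ultimately have "1 \<le> norm ((2 * R) *\<^sub>R n)"
      using R n by (intro int_lattice_norm_ge_1) auto
    then show False using R n by simp
  qed
  have far: "\<kappa> * pi / 2 < norm (q - k)"
    if "l \<in> int_lattice" "k \<in> int_lattice" "k \<noteq> l" "norm (q - l) = R" for q k l :: "real ^ 'n"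
    using int_lattice_other_ge[OF that(1,2) that(3)[symmetric], of q] that(4) R by (simp add: R_def)
  have "(\<integral>z. - 2 / \<kappa>\<^sup>2 * indicator {x} z + 2 / \<kappa>\<^sup>2 * indicator {y} z \<partial>\<nu>) = 0"
  proof (rule integral_third_diff_limit_eq_0[OF \<kappa>(1) less_imp_le[OF \<kappa>(2)] n \<nu> const, of _ p])
    show "AE z in \<nu>. \<forall>w. z = torus_proj w \<longrightarrow>
      ((\<lambda>h. third_diff (\<lambda>t. torus_bump \<kappa> (p - w + t *\<^sub>R n)) h / h\<^sup>2)
        \<longlongrightarrow> - 2 / \<kappa>\<^sup>2 * indicator {x} z + 2 / \<kappa>\<^sup>2 * indicator {y} z) (at_right 0)"
    proof (intro AE_I2 allI impI)
      fix z :: "'n torus" and w assume z: "z = torus_proj w"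
      consider "z = x" | "z = y" | "z \<noteq> x" "z \<noteq> y" by blast
      then show "((\<lambda>h. third_diff (\<lambda>t. torus_bump \<kappa> (p - w + t *\<^sub>R n)) h / h\<^sup>2)
        \<longlongrightarrow> - 2 / \<kappa>\<^sup>2 * indicator {x} z + 2 / \<kappa>\<^sup>2 * indicator {y} z) (at_right 0)"
      proof cases
        case 1
        let ?l = "p - R *\<^sub>R n - w"
        have l: "?l \<in> int_lattice" using 1 z unfolding x_def by (metis torus_proj_eq_iff)
        have eq: "p - w - ?l = R *\<^sub>R n" by simp
        have "\<kappa> * pi / 2 < norm (p - w - k)" if k: "k \<in> int_lattice" "k \<noteq> ?l" for k
          using far[OF l k] n R by (simp add: eq)
        from third_diff_torus_bump_on_sphere(1)[OF \<kappa>(1) n l this] eq 1 \<open>x \<noteq> y\<close>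
        show ?thesis by (simp add: R_def)
      next
        case 2
        let ?l = "p + R *\<^sub>R n - w"
        have l: "?l \<in> int_lattice" using 2 z unfolding y_def by (metis torus_proj_eq_iff)
        have eq: "p - w - ?l = - R *\<^sub>R n" by simp
        have "\<kappa> * pi / 2 < norm (p - w - k)" if k: "k \<in> int_lattice" "k \<noteq> ?l" for k
          using far[OF l k] n R by (simp add: eq)
        from third_diff_torus_bump_on_sphere(2)[OF \<kappa>(1) n l this] eq 2 \<open>x \<noteq> y\<close>
        show ?thesis by (simp add: R_def)
      next
        case 3
        have "infdist (p - w) int_lattice \<noteq> R"
        proof
          assume "infdist (p - w) int_lattice = R"
          moreover obtain k where k: "k \<in> int_lattice" "infdist (p - w) int_lattice = norm (p - w - k)"
            by (rule infdist_int_lattice_attained)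
          moreover define s where "s = (p - w - k) $ i"
          then have s: "p - w - k = s *\<^sub>R n" by (metis one_dim)
          ultimately have "s = R \<or> s = - R" using n by auto
          then have "w + k = p - R *\<^sub>R n \<or> w + k = p + R *\<^sub>R n"
            using s by (auto simp: algebra_simps)
          then have "z = x \<or> z = y"
            unfolding x_def y_def z using torus_proj_add_lattice[OF k(1), of w] by auto
          then show False using 3 by blast
        qed
        from third_diff_torus_bump_off_sphere[OF \<kappa>(1) less_imp_le[OF \<kappa>(2)] n this[unfolded R_def]] 3
        show ?thesis by simp
      qed
    qed
  qed measurable
  moreover have ind: "integrable \<nu> (\<lambda>z. c * indicator {a} z)" for a :: "'n torus" and c :: real
    by (intro integrable_mult_right integrable_real_indicator) (simp_all add: \<nu>D less_top[symmetric])
  ultimately have "- 2 / \<kappa>\<^sup>2 * measure \<nu> {x} + 2 / \<kappa>\<^sup>2 * measure \<nu> {y} = 0"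
    by (subst (asm) Bochner_Integration.integral_add[OF ind ind]) (simp add: \<nu>D)
  then have "measure \<nu> {x} = measure \<nu> {y}" using \<kappa> by (simp add: field_simps)
  moreover have "x = torus_proj u" by (simp add: x_def p_def)
  moreover have "y = torus_proj (u + (\<kappa> * pi) *\<^sub>R axis i 1)"
  proof -
    have "p + R *\<^sub>R n = u + (R + R) *\<^sub>R n" unfolding p_def scaleR_add_left by simp
    also have "R + R = \<kappa> * pi" by (simp add: R_def)
    finally show ?thesis by (simp only: y_def n_def)
  qed
  ultimately show ?thesis by simp
qed

lemma const_potential_no_atom_if_irrational:
  fixes \<nu> :: "'n::finite torus measure"
  assumes \<kappa>: "0 < \<kappa>" "\<kappa> * pi < 1" "\<kappa> * pi \<notin> \<rat>" and dim: "\<And>j. j = (i :: 'n)" and \<nu>: "\<nu> \<in> radon_measures"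
    and const: "\<And>x. HK_potential \<kappa> \<nu> x = c"
  shows "measure \<nu> {x} = 0"
proof (rule ccontr)
  note \<nu>D = radon_measuresD[OF \<nu>]
  interpret finite_measure \<nu> by (rule \<nu>D)
  assume "measure \<nu> {x} \<noteq> 0"
  then have pos: "0 < measure \<nu> {x}" by (simp add: less_le)
  obtain u where u: "x = torus_proj u" by (rule torus_proj_surj)
  define z where "z m = torus_proj (u + (real m * (\<kappa> * pi)) *\<^sub>R axis i 1)" for m
  have mass: "measure \<nu> {z m} = measure \<nu> {x}" for m
  proof (induction m)
    case (Suc m)
    have "z (Suc m) = torus_proj ((u + (real m * (\<kappa> * pi)) *\<^sub>R axis i 1) + (\<kappa> * pi) *\<^sub>R axis i 1)"
      by (simp add: z_def algebra_simps)
    then show ?case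
      using const_potential_atom_shift[OF \<kappa>(1,2) dim \<nu> const] Suc by (simp add: z_def)
  qed (simp add: z_def u)
  \<comment> \<open>A repetition would express \<kappa> * pi as an integer divided by the nonzero
    integer \<open>m - k\<close>.\<close>
  have "inj z"
  proof (rule injI, rule ccontr)
    fix m k assume "z m = z k" "m \<noteq> k"
    then have "((real m * (\<kappa> * pi)) *\<^sub>R axis i 1 - (real k * (\<kappa> * pi)) *\<^sub>R axis i 1) \<in> (int_lattice :: (real ^ 'n) set)"
      by (simp add: z_def torus_proj_eq_iff)
    then have "real m * (\<kappa> * pi) - real k * (\<kappa> * pi) \<in> \<int>"
      by (auto simp: int_lattice_def dest: spec[of _ i])
    then obtain a where a: "(real m - real k) * (\<kappa> * pi) = of_int a"
      by (auto elim!: Ints_cases simp: left_diff_distrib)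
    then have "\<kappa> * pi = of_int a / (of_int (int m - int k))"
      using \<open>m \<noteq> k\<close> by (simp add: field_simps)
    then show False using \<kappa>(3) by (metis Rats_divide Rats_of_int)
  qed
  have "real N * measure \<nu> {x} \<le> measure \<nu> UNIV" for N
  proof -
    have "measure \<nu> (z ` {..<N}) = (\<Sum>y\<in>z ` {..<N}. measure \<nu> {y})"
      by (rule finite_measure_eq_sum_singleton) (auto simp: \<nu>D)
    also have "\<dots> = real N * measure \<nu> {x}"
      using inj_on_subset[OF \<open>inj z\<close>] by (subst sum.reindex) (auto simp: mass)
    finally show ?thesis
      using bounded_measure[of "z ` {..<N}"] by (simp add: \<nu>D)
  qed
  moreover obtain N where "measure \<nu> UNIV < real N * measure \<nu> {x}"
    using reals_Archimedean3[OF pos] by blast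
  ultimately show False by (meson not_less)
qed

section \<open>Dimension one: existence for rational \<kappa> * pi \<le> 1\<close>

lemma sum_cos_squared_consecutive:
  fixes \<theta> :: real
  assumes "0 < p"
  shows "(\<Sum>m<2 * p. (cos (\<theta> - real m * pi / (2 * real p)))\<^sup>2) = real p"
proof -
  let ?f = "\<lambda>m. (cos (\<theta> - real m * pi / (2 * real p)))\<^sup>2"
  have "(\<Sum>m<2 * p. ?f m) = (\<Sum>m<p. ?f m) + (\<Sum>m<p. ?f (p + m))"
  proof -
    have "(\<Sum>m<p + n. f m) = (\<Sum>m<p. f m) + (\<Sum>m<n. f (p + m))" for n and f :: "nat \<Rightarrow> real"
      by (induction n) simp_all
    from this[where n = p and f = ?f] show ?thesis by (simp only: mult_2)
  qed
  also have "(\<Sum>m<p. ?f (p + m)) = (\<Sum>m<p. (sin (\<theta> - real m * pi / (2 * real p)))\<^sup>2)"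
  proof (rule sum.cong[OF refl])
    fix m
    have "\<theta> - real (p + m) * pi / (2 * real p) = (\<theta> - real m * pi / (2 * real p)) - pi / 2"
      using assms by (simp add: field_simps)
    then show "?f (p + m) = (sin (\<theta> - real m * pi / (2 * real p)))\<^sup>2"
      by (simp only: cos_diff) simp
  qed
  finally show ?thesis by (simp flip: sum.distrib)
qed

text \<open>Lets the sum over one period of the grid start anywhere, so that it can be centred at
  the evaluation point.\<close>

lemma sum_shift_periodic:
  fixes F :: "int \<Rightarrow> 'a::ab_group_add"
  assumes "\<And>k. F (k + int Q) = F k"
  shows "(\<Sum>j<Q. F (c + int j)) = (\<Sum>j<Q. F (int j))"
proof -
  have step: "(\<Sum>j<Q. F (c + 1 + int j)) = (\<Sum>j<Q. F (c + int j))" for c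
  proof -
    have "(\<Sum>j<Q. F (c + int j)) + F (c + int Q) = F c + (\<Sum>j<Q. F (c + int (Suc j)))"
      using sum.lessThan_Suc[of "\<lambda>j. F (c + int j)" Q] sum.lessThan_Suc_shift[of "\<lambda>j. F (c + int j)" Q]
      by (simp add: algebra_simps)
    then show ?thesis by (simp add: assms algebra_simps)
  qed
  show ?thesis
  proof (induction c rule: int_induct[where k = 0])
    case (step1 c)
    then show ?case using step[of c] by simp
  next
    case (step2 c)
    then show ?case using step[of "c - 1"] by simp
  qed simp
qed

text \<open>
  With \<open>\<kappa> * pi = p / q\<close> and step \<open>1 / (2 * q)\<close>, exactly \<open>2 * p\<close> consecutive grid points see a given
  point, and these pair up at phase difference \<open>pi / 2\<close>.
\<close>

lemma sum_torus_bump_grid: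
  fixes u :: "real ^ 'n::finite"
  assumes \<kappa>: "0 < \<kappa>" "\<kappa> * pi = real p / real q" and pq: "0 < p" "p \<le> q" and dim: "\<And>j. j = (i :: 'n)"
  shows "(\<Sum>j<2 * q. torus_bump \<kappa> (u - (real j / (2 * real q)) *\<^sub>R axis i 1)) = real p"
proof -
  define x where "x = u $ i"
  have u: "u = x *\<^sub>R axis i 1"
    unfolding vec_eq_iff x_def by (metis dim axis_nth mult.right_neutral real_scaleR_def vector_scaleR_component)
  define Q where "Q = 2 * q"
  have Q: "0 < real Q" using pq by (simp add: Q_def)
  define F where "F k = torus_bump \<kappa> ((x - of_int k / real Q) *\<^sub>R (axis i 1 :: real ^ 'n))" for k
  have per: "F (k + int Q) = F k" for k
  proof -
    have "(x - of_int (k + int Q) / real Q) *\<^sub>R (axis i 1 :: real ^ 'n)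
        = (x - of_int k / real Q) *\<^sub>R axis i 1 + of_int (- 1) *\<^sub>R axis i 1"
      using Q by (simp add: add_divide_distrib algebra_simps)
    then show ?thesis
      unfolding F_def by (simp only: torus_bump_add_lattice[OF axis_in_int_lattice])
  qed
  \<comment> \<open>Rounding up keeps the offset in the half-open interval from -1 (excluded) to 0
    (included), so the same \<open>2 * p\<close> indices serve every \<open>x\<close>, on or off the
    grid.\<close>
  define \<epsilon> where "\<epsilon> = real Q * x - of_int \<lceil>real Q * x\<rceil>"
  have \<epsilon>: "- 1 < \<epsilon>" "\<epsilon> \<le> 0" unfolding \<epsilon>_def by linarith+
  \<comment> \<open>From this start all \<open>Q\<close> displacements have absolute value at most
    \<open>1 / 2\<close>, where the distance on the circle is the absolute value.\<close>
  define c where "c = \<lceil>real Q * x\<rceil> - int q"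
  let ?g = "\<lambda>j. trunc_cos_sq ((\<epsilon> + real q - real j) * pi / (2 * real p))"
  have F: "F (c + int j) = ?g j" if "j < Q" for j
  proof -
    define t where "t = x - of_int (c + int j) / real Q"
    have Qt: "real Q * t = \<epsilon> + real q - real j"
      using Q by (simp add: t_def \<epsilon>_def c_def field_simps)
    have "real j \<le> 2 * real q - 1" using that by (simp add: Q_def)
    then have "\<bar>real Q * t\<bar> \<le> real q" unfolding Qt using \<epsilon> by linarith
    then have "\<bar>t\<bar> \<le> 1 / 2" using Q by (simp add: Q_def abs_mult field_simps)
    moreover have "t / \<kappa> = (real Q * t) * pi / (2 * real p)"
      using \<kappa> pq by (simp add: Q_def field_simps)
    moreover have "trunc_cos_sq (\<bar>t\<bar> / \<kappa>) = trunc_cos_sq (t / \<kappa>)"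
      using \<kappa> by (simp add: trunc_cos_sq_def)
    ultimately show ?thesis
      unfolding F_def t_def[symmetric] by (simp add: torus_bump_axis Qt)
  qed
  have edge: "pi / 2 \<le> \<bar>r * pi / (2 * real p)\<bar> \<longleftrightarrow> real p \<le> \<bar>r\<bar>"
    "\<bar>r * pi / (2 * real p)\<bar> \<le> pi / 2 \<longleftrightarrow> \<bar>r\<bar> \<le> real p" for r :: real
    using pq by (auto simp: abs_mult field_simps)
  have out: "?g j = 0" if "j \<in> {..<Q} - {q - p..<q + p}" for j
  proof (rule trunc_cos_sq_outside)
    have "real p \<le> \<bar>\<epsilon> + real q - real j\<bar>"
    proof (cases "j < q - p")
      case True
      then have "real j + 1 \<le> real q - real p" using pq by linarith
      then show ?thesis using \<epsilon> by linarith
    next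
      case False
      then have "real q + real p \<le> real j" using that by auto
      then show ?thesis using \<epsilon> by linarith
    qed
    then show "pi / 2 \<le> \<bar>(\<epsilon> + real q - real j) * pi / (2 * real p)\<bar>"
      by (simp only: edge)
  qed
  have inside: "?g (m + (q - p)) = (cos ((\<epsilon> + real p) * pi / (2 * real p) - real m * pi / (2 * real p)))\<^sup>2"
    if "m < 2 * p" for m
  proof -
    have eq: "(\<epsilon> + real q - real (m + (q - p))) * pi / (2 * real p)
        = (\<epsilon> + real p) * pi / (2 * real p) - real m * pi / (2 * real p)"
      using pq by (simp add: of_nat_diff diff_divide_distrib[symmetric] left_diff_distrib[symmetric])
    have "real m \<le> 2 * real p - 1" using that by linarith
    then have "\<bar>\<epsilon> + real q - real (m + (q - p))\<bar> \<le> real p"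
      using \<epsilon> pq by (simp add: of_nat_diff)
    then have "\<bar>(\<epsilon> + real q - real (m + (q - p))) * pi / (2 * real p)\<bar> \<le> pi / 2"
      by (simp only: edge)
    from trunc_cos_sq_inside[OF this] show ?thesis by (simp only: eq)
  qed
  have "(\<Sum>j<2 * q. torus_bump \<kappa> (u - (real j / (2 * real q)) *\<^sub>R axis i 1)) = (\<Sum>j<Q. F (int j))"
    by (simp add: F_def Q_def u algebra_simps)
  also have "\<dots> = (\<Sum>j<Q. F (c + int j))"
    by (rule sum_shift_periodic[of F Q, OF per, symmetric])
  also have "\<dots> = (\<Sum>j<Q. ?g j)" using F by simp
  also have "\<dots> = (\<Sum>j\<in>{q - p..<q + p}. ?g j)"
    using pq out by (intro sum.mono_neutral_right) (auto simp: Q_def)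
  also have "{q - p..<q + p} = {0 + (q - p)..<2 * p + (q - p)}" using pq by (simp add: add.commute)
  also have "(\<Sum>j\<in>\<dots>. ?g j) = (\<Sum>m\<in>{0..<2 * p}. ?g (m + (q - p)))"
    by (rule sum.shift_bounds_nat_ivl)
  also have "\<dots> = (\<Sum>m<2 * p. (cos ((\<epsilon> + real p) * pi / (2 * real p) - real m * pi / (2 * real p)))\<^sup>2)"
    by (intro sum.cong inside) auto
  also have "\<dots> = real p" by (rule sum_cos_squared_consecutive[OF pq(1)])
  finally show ?thesis .
qed

lemma discrete_radon_measure_const_potential:
  assumes \<kappa>: "0 < \<kappa>" "\<kappa> * pi \<in> \<rat>" "\<kappa> * pi \<le> 1" and dim: "\<And>j. j = (i :: 'n)" and c: "0 \<le> c"
  obtains \<nu> :: "'n::finite torus measure" where "\<nu> \<in> radon_measures" "discrete_measure \<nu>"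
    "\<And>x. HK_potential \<kappa> \<nu> x = c"
proof -
  have "0 < \<kappa> * pi" using \<kappa> by simp
  from \<kappa>(2) obtain p q :: nat where "q \<noteq> 0" "\<bar>\<kappa> * pi\<bar> = real p / real q"
    by (rule Rats_abs_nat_div_natE)
  with \<open>0 < \<kappa> * pi\<close> have pq: "\<kappa> * pi = real p / real q" "0 < p" "0 < q"
    by (auto intro: gr0I)
  then have "p \<le> q" using \<kappa>(3) by (simp add: divide_le_eq_1)
  define z where "z j = torus_proj ((real j / (2 * real q)) *\<^sub>R (axis i 1 :: real ^ 'n))" for j
  \<comment> \<open>Over the \<open>2 * q\<close> equally spaced points the kernel sums to
    \<open>p\<close>, whatever the evaluation point; hence the weight \<open>c / p\<close>.\<close>
  define M where "M = point_measure {..<2 * q} (\<lambda>_. ennreal (c / real p))"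
  define \<nu> where "\<nu> = distr M borel z"
  have z: "z \<in> measurable M borel" by (simp add: M_def measurable_def space_point_measure)
  have int: "(\<integral>\<^sup>+y. f y \<partial>\<nu>) = (\<Sum>j<2 * q. ennreal (c / real p) * f (z j))" if "f \<in> borel_measurable borel" for f
    using that unfolding \<nu>_def
    by (subst nn_integral_distr[OF z]) (simp_all add: M_def nn_integral_point_measure_finite mult.commute)
  have em: "emeasure \<nu> B = (\<Sum>j<2 * q. ennreal (c / real p) * indicator B (z j))" if "B \<in> sets borel" for B
    using int[of "indicator B"] that by (simp add: \<nu>_def)
  have \<nu>: "\<nu> \<in> radon_measures"
    using em[of UNIV] by (auto simp: radon_measures_def \<nu>_def ennreal_mult_eq_top_iff intro!: finite_measureI)
  show thesis
  proof (rule that[OF \<nu>])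
    show "discrete_measure \<nu>"
      unfolding discrete_measure_def
    proof (intro conjI exI ballI)
      fix B :: "'n torus set" assume B: "B \<in> sets borel"
      have "(\<Sum>j. (if j < 2 * q then ennreal (c / real p) else 0) * emeasure (return borel (z j)) B)
          = (\<Sum>j<2 * q. (if j < 2 * q then ennreal (c / real p) else 0) * emeasure (return borel (z j)) B)"
        by (rule suminf_finite) auto
      then show "emeasure \<nu> B = (\<Sum>j. (if j < 2 * q then ennreal (c / real p) else 0) * emeasure (return borel (z j)) B)"
        using B by (simp add: em)
    qed (simp add: \<nu>_def)
    fix x :: "'n torus"
    obtain u where u: "x = torus_proj u" by (rule torus_proj_surj)
    have "ennreal (HK_potential \<kappa> \<nu> x) = (\<Sum>j<2 * q. ennreal (c / real p) * ennreal (HK_kernel \<kappa> x (z j)))"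
      unfolding ennreal_HK_potential[OF \<nu>, symmetric] by (rule int) measurable
    also have "\<dots> = ennreal (\<Sum>j<2 * q. c / real p * HK_kernel \<kappa> x (z j))"
      using c by (simp add: sum_ennreal flip: ennreal_mult)
    also have "(\<Sum>j<2 * q. c / real p * HK_kernel \<kappa> x (z j)) = c / real p * real p"
      unfolding sum_distrib_left[symmetric] u z_def HK_kernel_eq_torus_bump
      using sum_torus_bump_grid[OF \<kappa>(1) pq(1,2) \<open>p \<le> q\<close> dim] by simp
    finally show "HK_potential \<kappa> \<nu> x = c" using c pq by simp
  qed
qed

theorem proposition4p8:
  fixes \<kappa> :: real
  assumes "0 < \<kappa>"
  shows "(1 < CARD('n::finite) \<longrightarrow>
            \<not> (\<exists>\<nu> :: 'n torus measure. HK_barycenter \<kappa> uniform_torus \<nu> \<and> discrete_measure \<nu>)) \<and>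
         (CARD('n) = 1 \<longrightarrow>
            (\<kappa> * pi \<notin> \<rat> \<or> 1 < \<kappa> * pi \<longrightarrow>
              \<not> (\<exists>\<nu> :: 'n torus measure. HK_barycenter \<kappa> uniform_torus \<nu> \<and> discrete_measure \<nu>)) \<and>
            (\<not> (\<kappa> * pi \<notin> \<rat> \<or> 1 < \<kappa> * pi) \<longrightarrow>
              (\<exists>\<nu> :: 'n torus measure. HK_barycenter \<kappa> uniform_torus \<nu> \<and> discrete_measure \<nu>)))"
proof -
  define K where "K = HK_potential \<kappa> uniform_torus (undefined :: 'n torus)"
  have K: "0 < K" unfolding K_def by (rule HK_potential_uniform_torus_pos[OF assms])
  have "HK_potential \<kappa> uniform_torus x = K" for x :: "'n torus"
    unfolding K_def by (rule HK_potential_uniform_torus_const)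
  then have bary: "HK_barycenter \<kappa> uniform_torus \<nu> \<longleftrightarrow>
      \<nu> \<in> radon_measures \<and> (\<forall>x. HK_potential \<kappa> \<nu> x = K\<^sup>2)" for \<nu> :: "'n torus measure"
    using HK_barycenter_uniform_torus_iff[OF assms, of \<nu>] by simp
  \<comment> \<open>The kink argument is independent of the dimension, so both nonexistence claims
    share one case split.\<close>
  have None: False if "HK_barycenter \<kappa> uniform_torus \<nu>" "discrete_measure \<nu>"
    and cases: "1 < \<kappa> * pi \<or> 1 < CARD('n) \<or> CARD('n) = 1 \<and> \<kappa> * pi \<notin> \<rat>"
    for \<nu> :: "'n torus measure"
  proof -
    from that have \<nu>: "\<nu> \<in> radon_measures" and const: "\<And>x. HK_potential \<kappa> \<nu> x = K\<^sup>2"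
      by (auto simp: bary)
    obtain A where A: "countable A" "AE y in \<nu>. y \<in> A"
      using discrete_measure_AE_countable \<open>discrete_measure \<nu>\<close> by blast
    have "0 < measure \<nu> UNIV"
      using HK_potential_le_mass[OF \<nu>, of \<kappa> undefined] K by (simp add: const) (meson less_le_trans zero_less_power)
    from radon_measure_atom[OF \<nu> A this] obtain x where x: "0 < measure \<nu> {x}" .
    have "measure \<nu> {x} = 0"
    proof (cases "1 < \<kappa> * pi")
      case True
      then show ?thesis by (rule const_potential_no_atom_if_kink[OF assms _ \<nu> const])
    next
      case le: False
      show ?thesis
      proof (cases "1 < CARD('n)")
        case True
        with le show ?thesis
          by (intro discrete_const_potential_no_atom_dim_ge_2[OF assms _ _ \<nu> const A]) auto
      next
        case False
        with le cases have card: "CARD('n) = 1" and irr: "\<kappa> * pi \<notin> \<rat>" by auto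
        \<comment> \<open>Since 1 is rational, irrationality excludes the boundary value and makes
          the inequality strict.\<close>
        then have "\<kappa> * pi < 1" using le by (metis Rats_1 linorder_less_linear)
        from const_potential_no_atom_if_irrational[OF assms this irr _ \<nu> const]
        show ?thesis using card card_1_singletonE by (metis UNIV_I singletonD)
      qed
    qed
    with x show False by simp
  qed
  moreover have "\<exists>\<nu> :: 'n torus measure. HK_barycenter \<kappa> uniform_torus \<nu> \<and> discrete_measure \<nu>"
    if card: "CARD('n) = 1" and rat: "\<kappa> * pi \<in> \<rat>" and le: "\<kappa> * pi \<le> 1"
  proof -
    obtain i :: 'n where "UNIV = {i}" using card_1_singletonE[OF card] by blast
    then have "j = i" for j by blast
    from discrete_radon_measure_const_potential[OF assms rat le this, of "K\<^sup>2"]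
    show ?thesis using bary by (metis zero_le_power2)
  qed
  ultimately show ?thesis by (auto simp: not_less)
qed

end
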